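(* Let $M$ be a Kähler–Poisson manifold with a star product with separation of variables $\ast$, let $E$ be a holomorphic Hermitian vector bundle of rank $d$ on $M$, and let $\ast_u$ be the star product on $C^\infty(\mathrm{End}(E^\ast))[[\nu]]$ given in any local holomorphic trivialization of $E$ by $f\ast_u g=\big((fu)\ast v\ast(gu)\big)\tilde u$. Given local sections $f,g$ of $\mathrm{End}(E^\ast)$, if $f$ is holomorphic or $g$ is antiholomorphic, then $f\ast_u g=fg$, where $fg$ is the pointwise composition of $f$ and $g$.
   Context: A Kähler–Poisson manifold is a complex manifold $M$ with a Poisson bracket whose Poisson tensor is of type $(1,1)$. A star product on $M$ is an associative product $f\ast g=\sum_{r\ge0}\nu^rC_r(f,g)$ on $C^\infty(M)[[\nu]]$, with $C_r$ bidifferential, $C_0(f,g)=fg$, $C_1(f,g)-C_1(g,f)=i\{f,g\}$, with unit the constant function $1$. It restricts to open subsets, and is with separation of variables if $f\ast g=fg$ for local functions $f,g$ whenever $f$ is holomorphic or $g$ is antiholomorphic. On matrix-valued functions $\ast$ denotes the matrix product with entries multiplied by $\ast$; juxtaposition denotes the pointwise matrix product. Let $h$ be the Hermitian metric on $E$ (linear in the first, conjugate linear in the second argument). A local holomorphic trivialization is given by a holomorphic frame $e_1,\dots,e_d$ of $E$ over an open set $U$; then $u=(h(e_i,e_j))_{ij}\in\mathrm{Mat}_d(C^\infty(U))$, $\tilde u$ is its pointwise inverse, and $v$ is its inverse with respect to $\ast$ (which exists). Sections of $E^\ast$ over $U$ are identified with column vectors $(s(e_i))_i$ and sections of $\mathrm{End}(E^\ast)$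 with $d\times d$ matrix-valued functions acting on these. The local formula for $\ast_u$ is compatible with change of trivialization and defines a global product. A local section $f$ of $\mathrm{End}(E^\ast)$ is holomorphic if its matrix in a holomorphic trivialization has holomorphic entries, and is called antiholomorphic if the matrix $\tilde u f u$ has antiholomorphic entries (equivalently, if the section $\tilde u f u$ of the antiholomorphic bundle $\mathrm{End}(\bar E)$ is antiholomorphic, where $u:\bar E\to E^\ast$ is the bundle isomorphism given by the metric). *)

theory Defs
  imports "HOL-Analysis.Analysis" "HOL-Computational_Algebra.Formal_Power_Series"
begin

unbundle no fps_syntax

fun k_smooth_on :: "nat \<Rightarrow> 'b::real_normed_vector set \<Rightarrow> ('b \<Rightarrow> 'c::real_normed_vector) \<Rightarrow> bool" where
  "k_smooth_on 0 S F \<longleftrightarrow> continuous_on S F"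
| "k_smooth_on (Suc k) S F \<longleftrightarrow>
     (\<forall>z\<in>S. F differentiable (at z)) \<and>
     (\<forall>w. k_smooth_on k S (\<lambda>z. frechet_derivative F (at z) w))"

definition holomorphic_cn :: "(complex^'n) set \<Rightarrow> (complex^'n \<Rightarrow> complex) \<Rightarrow> bool" where
  "holomorphic_cn S F \<longleftrightarrow>
     (\<forall>z\<in>S. \<exists>D. (F has_derivative D) (at z) \<and> (\<forall>c w. D (c *s w) = c * D w))"

definition d_hol :: "'n \<Rightarrow> (complex^'n \<Rightarrow> complex) \<Rightarrow> complex^'n \<Rightarrow> complex" where
  "d_hol k F z = (frechet_derivative F (at z) (axis k 1) - \<i> * frechet_derivative F (at z) (axis k \<i>)) / 2"

definition d_antihol :: "'n \<Rightarrow> (complex^'n \<Rightarrow> complex) \<Rightarrow> complex^'n \<Rightarrow> complex" where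
  "d_antihol k F z = (frechet_derivative F (at z) (axis k 1) + \<i> * frechet_derivative F (at z) (axis k \<i>)) / 2"

text \<open>Iterated directional derivatives; with directions in \<^term>\<open>Basis\<close> these are
  the real partial derivatives of all orders.\<close>

fun dirderivs :: "'b::real_normed_vector list \<Rightarrow> ('b \<Rightarrow> complex) \<Rightarrow> 'b \<Rightarrow> complex" where
  "dirderivs [] F = F"
| "dirderivs (b # bs) F = (\<lambda>z. frechet_derivative (dirderivs bs F) (at z) b)"

definition multi_indices :: "nat \<Rightarrow> 'b::euclidean_space list set" where
  "multi_indices N = {bs. set bs \<subseteq> Basis \<and> length bs \<le> N}"


text \<open>The manifold is the whole type \<^typ>\<open>'a\<close>. A function on an open subset \<open>V\<close> is
  represented by a total function whose values outside \<open>V\<close> are irrelevant.\<close>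

type_synonym ('a, 'n) chart = "'a set \<times> ('a \<Rightarrow> complex^'n)"

definition local_rep :: "('a, 'n) chart \<Rightarrow> ('a \<Rightarrow> complex) \<Rightarrow> complex^'n \<Rightarrow> complex" where
  "local_rep ch f = f \<circ> inv_into (fst ch) (snd ch)"

locale complex_manifold =
  fixes A :: "('a::{t2_space,second_countable_topology}, 'n::finite) chart set"
  assumes chart_open: "(V, \<phi>) \<in> A \<Longrightarrow> open V \<and> open (\<phi> ` V)"
    and chart_homeomorphism: "(V, \<phi>) \<in> A \<Longrightarrow> homeomorphism V (\<phi> ` V) \<phi> (inv_into V \<phi>)"
    and charts_cover: "\<exists>(V, \<phi>)\<in>A. p \<in> V"
    and transition_holomorphic:
      "(V, \<phi>) \<in> A \<Longrightarrow> (V', \<phi>') \<in> A \<Longrightarrow>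
         holomorphic_cn (\<phi> ` (V \<inter> V')) (\<lambda>z. \<phi>' (inv_into V \<phi> z) $ i)"

definition smooth_on :: "('a, 'n::finite) chart set \<Rightarrow> 'a set \<Rightarrow> ('a \<Rightarrow> complex) \<Rightarrow> bool" where
  "smooth_on A V f \<longleftrightarrow>
     (\<forall>(W, \<phi>)\<in>A. \<forall>k. k_smooth_on k (\<phi> ` (W \<inter> V)) (local_rep (W, \<phi>) f))"

definition hol_on :: "('a, 'n::finite) chart set \<Rightarrow> 'a set \<Rightarrow> ('a \<Rightarrow> complex) \<Rightarrow> bool" where
  "hol_on A V f \<longleftrightarrow> (\<forall>(W, \<phi>)\<in>A. holomorphic_cn (\<phi> ` (W \<inter> V)) (local_rep (W, \<phi>) f))"

definition antihol_on :: "('a, 'n::finite) chart set \<Rightarrow> 'a set \<Rightarrow> ('a \<Rightarrow> complex) \<Rightarrow> bool" where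
  "antihol_on A V f \<longleftrightarrow> hol_on A V (\<lambda>x. cnj (f x))"


text \<open>A bilinear operator that is defined on an open set together with all of its restrictions
  to smaller open sets is represented by a single operator on total functions: its value at
  \<open>x\<close> is only constrained when both arguments are smooth on an open neighbourhood of
  \<open>x\<close>, and then depends only on the germs of the arguments there.\<close>

type_synonym 'a biop = "('a \<Rightarrow> complex) \<Rightarrow> ('a \<Rightarrow> complex) \<Rightarrow> 'a \<Rightarrow> complex"

definition bidifferential ::
  "('a::topological_space, 'n::finite) chart set \<Rightarrow> 'a biop \<Rightarrow> bool" where
  "bidifferential A B \<longleftrightarrow>
     (\<forall>V f g. open V \<longrightarrow> smooth_on A V f \<longrightarrow> smooth_on A V g \<longrightarrow> smooth_on A V (B f g)) \<and>
     (\<forall>p. \<exists>(V, \<phi>)\<in>A. \<exists>W N c. open W \<and> p \<in> W \<and> W \<subseteq> V \<and>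
        (\<forall>\<alpha> \<beta>. smooth_on A W (c \<alpha> \<beta>)) \<and>
        (\<forall>W' f g. open W' \<longrightarrow> W' \<subseteq> W \<longrightarrow> smooth_on A W' f \<longrightarrow> smooth_on A W' g \<longrightarrow>
          (\<forall>x\<in>W'. B f g x =
             (\<Sum>\<alpha>\<in>multi_indices N. \<Sum>\<beta>\<in>multi_indices N.
                c \<alpha> \<beta> x * dirderivs \<alpha> (local_rep (V, \<phi>) f) (\<phi> x)
                        * dirderivs \<beta> (local_rep (V, \<phi>) g) (\<phi> x)))))"

locale poisson_bracket = complex_manifold A
  for A :: "('a::{t2_space,second_countable_topology}, 'n::finite) chart set" +
  fixes br :: "'a biop"
  assumes bracket_smooth: "open V \<Longrightarrow> smooth_on A V f \<Longrightarrow> smooth_on A V g \<Longrightarrow> smooth_on A V (br f g)"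
    and bracket_local: "open V \<Longrightarrow> smooth_on A V f \<Longrightarrow> smooth_on A V g \<Longrightarrow>
      (\<And>y. y \<in> V \<Longrightarrow> f y = f' y) \<Longrightarrow> (\<And>y. y \<in> V \<Longrightarrow> g y = g' y) \<Longrightarrow> x \<in> V \<Longrightarrow>
      br f g x = br f' g' x"
    and bracket_linear: "open V \<Longrightarrow> smooth_on A V f \<Longrightarrow> smooth_on A V g \<Longrightarrow> smooth_on A V k \<Longrightarrow> x \<in> V \<Longrightarrow>
      br (\<lambda>y. a * f y + b * g y) k x = a * br f k x + b * br g k x"
    and bracket_antisym: "open V \<Longrightarrow> smooth_on A V f \<Longrightarrow> smooth_on A V g \<Longrightarrow> x \<in> V \<Longrightarrow>
      br f g x = - br g f x"
    and bracket_leibniz: "open V \<Longrightarrow> smooth_on A V f \<Longrightarrow> smooth_on A V g \<Longrightarrow> smooth_on A V k \<Longrightarrow> x \<in> V \<Longrightarrow>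
      br f (\<lambda>y. g y * k y) x = br f g x * k x + g x * br f k x"
    and bracket_jacobi: "open V \<Longrightarrow> smooth_on A V f \<Longrightarrow> smooth_on A V g \<Longrightarrow> smooth_on A V k \<Longrightarrow> x \<in> V \<Longrightarrow>
      br f (br g k) x + br g (br k f) x + br k (br f g) x = 0"

text \<open>Type (1,1): in local holomorphic coordinates the Poisson tensor is
  \<open>\<Sum> \<pi>\<^sub>k\<^sub>l \<partial>\<^sub>k \<and> \<partial>bar\<^sub>l\<close>.\<close>

locale kaehler_poisson_manifold = poisson_bracket A br
  for A :: "('a::{t2_space,second_countable_topology}, 'n::finite) chart set" and br +
  assumes type_1_1: "(V, \<phi>) \<in> A \<Longrightarrow>
    \<exists>\<pi>. (\<forall>k l. smooth_on A V (\<pi> k l)) \<and>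
      (\<forall>W f g. open W \<longrightarrow> W \<subseteq> V \<longrightarrow> smooth_on A W f \<longrightarrow> smooth_on A W g \<longrightarrow>
        (\<forall>x\<in>W. br f g x =
          (\<Sum>k\<in>UNIV. \<Sum>l\<in>UNIV. \<pi> k l x *
            (d_hol k (local_rep (V, \<phi>) f) (\<phi> x) * d_antihol l (local_rep (V, \<phi>) g) (\<phi> x)
             - d_hol k (local_rep (V, \<phi>) g) (\<phi> x) * d_antihol l (local_rep (V, \<phi>) f) (\<phi> x)))))"


text \<open>Formal functions are maps into \<^typ>\<open>complex fps\<close>, the formal parameter being
  \<^const>\<open>fps_X\<close>.\<close>

type_synonym 'a formal_fun = "'a \<Rightarrow> complex fps"

definition coef :: "'a formal_fun \<Rightarrow> nat \<Rightarrow> 'a \<Rightarrow> complex" where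
  "coef f n x = fps_nth (f x) n"

definition const_formal :: "('a \<Rightarrow> complex) \<Rightarrow> 'a formal_fun" where
  "const_formal f x = fps_const (f x)"

definition formal_smooth_on :: "('a, 'n::finite) chart set \<Rightarrow> 'a set \<Rightarrow> 'a formal_fun \<Rightarrow> bool" where
  "formal_smooth_on A V f \<longleftrightarrow> (\<forall>n. smooth_on A V (coef f n))"

definition star :: "(nat \<Rightarrow> 'a biop) \<Rightarrow> 'a formal_fun \<Rightarrow> 'a formal_fun \<Rightarrow> 'a formal_fun" where
  "star C f g x =
     Abs_fps (\<lambda>n. \<Sum>r\<le>n. \<Sum>s\<le>n - r. C r (coef f s) (coef g (n - r - s)) x)"

locale star_product = kaehler_poisson_manifold A br
  for A :: "('a::{t2_space,second_countable_topology}, 'n::finite) chart set" and br +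
  fixes C :: "nat \<Rightarrow> 'a biop"
  assumes C_bidifferential: "bidifferential A (C r)"
    and C_0: "open V \<Longrightarrow> smooth_on A V f \<Longrightarrow> smooth_on A V g \<Longrightarrow> x \<in> V \<Longrightarrow> C 0 f g x = f x * g x"
    and C_1: "open V \<Longrightarrow> smooth_on A V f \<Longrightarrow> smooth_on A V g \<Longrightarrow> x \<in> V \<Longrightarrow>
      C 1 f g x - C 1 g f x = \<i> * br f g x"
    and star_unit: "open V \<Longrightarrow> formal_smooth_on A V F \<Longrightarrow> x \<in> V \<Longrightarrow>
      star C (\<lambda>_. 1) F x = F x \<and> star C F (\<lambda>_. 1) x = F x"
    and star_assoc: "open V \<Longrightarrow> formal_smooth_on A V F \<Longrightarrow> formal_smooth_on A V G \<Longrightarrow>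
      formal_smooth_on A V H \<Longrightarrow> x \<in> V \<Longrightarrow>
      star C (star C F G) H x = star C F (star C G H) x"

locale star_product_sep_vars = star_product A br C
  for A :: "('a::{t2_space,second_countable_topology}, 'n::finite) chart set" and br C +
  assumes separation: "open V \<Longrightarrow> smooth_on A V f \<Longrightarrow> smooth_on A V g \<Longrightarrow>
      hol_on A V f \<or> antihol_on A V g \<Longrightarrow> x \<in> V \<Longrightarrow>
      star C (const_formal f) (const_formal g) x = const_formal (\<lambda>y. f y * g y) x"

definition mat_star :: "(nat \<Rightarrow> 'a biop) \<Rightarrow> ('a \<Rightarrow> complex fps^'d^'d) \<Rightarrow> ('a \<Rightarrow> complex fps^'d^'d)
    \<Rightarrow> 'a \<Rightarrow> complex fps^'d^'d" where
  "mat_star C F G x = (\<chi> i j. \<Sum>k\<in>UNIV. star C (\<lambda>y. F y $ i $ k) (\<lambda>y. G y $ k $ j) x)"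

definition const_mat :: "complex^'d^'d \<Rightarrow> complex fps^'d^'d" where
  "const_mat M = (\<chi> i j. fps_const (M $ i $ j))"

definition is_star_inverse :: "('a, 'n::finite) chart set \<Rightarrow> (nat \<Rightarrow> 'a biop) \<Rightarrow> 'a set \<Rightarrow>
    ('a \<Rightarrow> complex fps^'d^'d) \<Rightarrow> ('a \<Rightarrow> complex fps^'d^'d) \<Rightarrow> bool" where
  "is_star_inverse A C W u v \<longleftrightarrow>
     (\<forall>i j. formal_smooth_on A W (\<lambda>x. v x $ i $ j)) \<and>
     (\<forall>x\<in>W. mat_star C u v x = mat 1 \<and> mat_star C v u x = mat 1)"


text \<open>The total space is \<open>{(x, w). w \<in> fibre E x}\<close>, the fibres being subspaces of an
  arbitrary complex vector space \<^typ>\<open>'v\<close> with scalar multiplication \<open>scaleE E\<close>; this is no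
  restriction, since abstract fibres embed into their direct sum over all points. The holomorphic
  structure is given by a covering family of local frames with holomorphic transition matrices. The
  rank is \<open>CARD('d)\<close>.\<close>

record ('a, 'v, 'd) hermitian_bundle =
  scaleE :: "complex \<Rightarrow> 'v \<Rightarrow> 'v"
  fibre :: "'a \<Rightarrow> 'v set"
  trivs :: "('a set \<times> ('d \<Rightarrow> 'a \<Rightarrow> 'v)) set"
  metric :: "'a \<Rightarrow> 'v \<Rightarrow> 'v \<Rightarrow> complex"

definition frame_on :: "('a, 'v::ab_group_add, 'd::finite) hermitian_bundle \<Rightarrow> 'a set \<Rightarrow>
    ('d \<Rightarrow> 'a \<Rightarrow> 'v) \<Rightarrow> bool" where
  "frame_on E W e \<longleftrightarrow> (\<forall>x\<in>W. inj (\<lambda>i. e i x) \<and>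
     \<not> module.dependent (scaleE E) (range (\<lambda>i. e i x)) \<and>
     module.span (scaleE E) (range (\<lambda>i. e i x)) = fibre E x)"

definition hol_related :: "('a, 'n::finite) chart set \<Rightarrow>
    ('a, 'v::ab_group_add, 'd::finite) hermitian_bundle \<Rightarrow> 'a set \<Rightarrow>
    ('d \<Rightarrow> 'a \<Rightarrow> 'v) \<Rightarrow> ('d \<Rightarrow> 'a \<Rightarrow> 'v) \<Rightarrow> bool" where
  "hol_related A E W e e' \<longleftrightarrow> (\<exists>g. (\<forall>i j. hol_on A W (g i j)) \<and>
     (\<forall>x\<in>W. \<forall>i. e i x = (\<Sum>j\<in>UNIV. scaleE E (g i j x) (e' j x))))"

definition holomorphic_frame :: "('a::topological_space, 'n::finite) chart set \<Rightarrow>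
    ('a, 'v::ab_group_add, 'd::finite) hermitian_bundle \<Rightarrow> 'a set \<Rightarrow> ('d \<Rightarrow> 'a \<Rightarrow> 'v) \<Rightarrow> bool" where
  "holomorphic_frame A E W e \<longleftrightarrow> open W \<and> frame_on E W e \<and>
     (\<forall>(W', e')\<in>trivs E. hol_related A E (W \<inter> W') e e')"

definition metric_matrix :: "('a, 'v, 'd::finite) hermitian_bundle \<Rightarrow>
    ('d \<Rightarrow> 'a \<Rightarrow> 'v) \<Rightarrow> 'a \<Rightarrow> complex^'d^'d" where
  "metric_matrix E e x = (\<chi> i j. metric E x (e i x) (e j x))"

locale holomorphic_vector_bundle = complex_manifold A
  for A :: "('a::{t2_space,second_countable_topology}, 'n::finite) chart set" +
  fixes E :: "('a, 'v::ab_group_add, 'd::finite) hermitian_bundle"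
  assumes ambient_vector_space: "vector_space (scaleE E)"
    and trivs_open: "(W, e) \<in> trivs E \<Longrightarrow> open W"
    and trivs_frame: "(W, e) \<in> trivs E \<Longrightarrow> frame_on E W e"
    and trivs_cover: "\<exists>(W, e)\<in>trivs E. x \<in> W"
    and trivs_compatible: "(W, e) \<in> trivs E \<Longrightarrow> (W', e') \<in> trivs E \<Longrightarrow>
      hol_related A E (W \<inter> W') e e'"

locale holomorphic_hermitian_bundle = holomorphic_vector_bundle A E
  for A :: "('a::{t2_space,second_countable_topology}, 'n::finite) chart set"
    and E :: "('a, 'v::ab_group_add, 'd::finite) hermitian_bundle" +
  assumes metric_linear: "v \<in> fibre E x \<Longrightarrow> v' \<in> fibre E x \<Longrightarrow> w \<in> fibre E x \<Longrightarrow>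
      metric E x (scaleE E a v + scaleE E b v') w = a * metric E x v w + b * metric E x v' w"
    and metric_hermitian: "v \<in> fibre E x \<Longrightarrow> w \<in> fibre E x \<Longrightarrow> metric E x w v = cnj (metric E x v w)"
    and metric_positive: "v \<in> fibre E x \<Longrightarrow> v \<noteq> 0 \<Longrightarrow> Re (metric E x v v) > 0"
    and metric_smooth: "holomorphic_frame A E W e \<Longrightarrow>
      smooth_on A W (\<lambda>x. metric_matrix E e x $ i $ j)"


text \<open>Elements of the dual fibre are extended by 0 outside the fibre, so that equality of functionals
  is equality of functions.\<close>

definition dual_fibre :: "('a, 'v::ab_group_add, 'd) hermitian_bundle \<Rightarrow> 'a \<Rightarrow> ('v \<Rightarrow> complex) set" where
  "dual_fibre E x = {s.
     (\<forall>v\<in>fibre E x. \<forall>w\<in>fibre E x. s (v + w) = s v + s w) \<and>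
     (\<forall>c. \<forall>v\<in>fibre E x. s (scaleE E c v) = c * s v) \<and>
     (\<forall>v. v \<notin> fibre E x \<longrightarrow> s v = 0)}"

type_synonym 'v dual_endo = "('v \<Rightarrow> complex) \<Rightarrow> 'v \<Rightarrow> complex"

definition dual_endos :: "('a, 'v::ab_group_add, 'd) hermitian_bundle \<Rightarrow> 'a \<Rightarrow> 'v dual_endo set" where
  "dual_endos E x = {T.
     (\<forall>s\<in>dual_fibre E x. T s \<in> dual_fibre E x) \<and>
     (\<forall>s\<in>dual_fibre E x. \<forall>t\<in>dual_fibre E x. T (\<lambda>v. s v + t v) = (\<lambda>v. T s v + T t v)) \<and>
     (\<forall>c. \<forall>s\<in>dual_fibre E x. T (\<lambda>v. c * s v) = (\<lambda>v. c * T s v))}"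

definition column :: "('d::finite \<Rightarrow> 'a \<Rightarrow> 'v) \<Rightarrow> 'a \<Rightarrow> ('v \<Rightarrow> complex) \<Rightarrow> complex^'d" where
  "column e x s = (\<chi> i. s (e i x))"

definition matrix_in :: "('a, 'v::ab_group_add, 'd::finite) hermitian_bundle \<Rightarrow>
    ('d \<Rightarrow> 'a \<Rightarrow> 'v) \<Rightarrow> ('a \<Rightarrow> 'v dual_endo) \<Rightarrow> 'a \<Rightarrow> complex^'d^'d" where
  "matrix_in E e f x =
     (THE F. \<forall>s\<in>dual_fibre E x. column e x (f x s) = F *v column e x s)"

definition smooth_section :: "('a::topological_space, 'n::finite) chart set \<Rightarrow>
    ('a, 'v::ab_group_add, 'd::finite) hermitian_bundle \<Rightarrow> 'a set \<Rightarrow> ('a \<Rightarrow> 'v dual_endo) \<Rightarrow> bool" where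
  "smooth_section A E U f \<longleftrightarrow> (\<forall>x\<in>U. f x \<in> dual_endos E x) \<and>
     (\<forall>W e. W \<subseteq> U \<longrightarrow> holomorphic_frame A E W e \<longrightarrow>
        (\<forall>i j. smooth_on A W (\<lambda>x. matrix_in E e f x $ i $ j)))"

text \<open>Holomorphy and antiholomorphy do not depend on the trivialization, so it suffices to
  require them in one trivialization near each point.\<close>

definition holomorphic_section :: "('a::topological_space, 'n::finite) chart set \<Rightarrow>
    ('a, 'v::ab_group_add, 'd::finite) hermitian_bundle \<Rightarrow> 'a set \<Rightarrow> ('a \<Rightarrow> 'v dual_endo) \<Rightarrow> bool" where
  "holomorphic_section A E U f \<longleftrightarrow> (\<forall>p\<in>U. \<exists>W e. p \<in> W \<and> W \<subseteq> U \<and> holomorphic_frame A E W e \<and>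
     (\<forall>i j. hol_on A W (\<lambda>x. matrix_in E e f x $ i $ j)))"

definition antiholomorphic_section :: "('a::topological_space, 'n::finite) chart set \<Rightarrow>
    ('a, 'v::ab_group_add, 'd::finite) hermitian_bundle \<Rightarrow> 'a set \<Rightarrow> ('a \<Rightarrow> 'v dual_endo) \<Rightarrow> bool" where
  "antiholomorphic_section A E U f \<longleftrightarrow> (\<forall>p\<in>U. \<exists>W e. p \<in> W \<and> W \<subseteq> U \<and> holomorphic_frame A E W e \<and>
     (\<forall>i j. antihol_on A W (\<lambda>x.
        (matrix_inv (metric_matrix E e x) ** matrix_in E e f x ** metric_matrix E e x) $ i $ j)))"


text \<open>A formal section is the sequence of its coefficients.\<close>

type_synonym ('a, 'v) formal_section = "nat \<Rightarrow> 'a \<Rightarrow> 'v dual_endo"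

definition formal_smooth_section :: "('a::topological_space, 'n::finite) chart set \<Rightarrow>
    ('a, 'v::ab_group_add, 'd::finite) hermitian_bundle \<Rightarrow> 'a set \<Rightarrow> ('a, 'v) formal_section \<Rightarrow> bool" where
  "formal_smooth_section A E U f \<longleftrightarrow> (\<forall>n. smooth_section A E U (f n))"

definition const_section :: "('a \<Rightarrow> 'v dual_endo) \<Rightarrow> ('a, 'v) formal_section" where
  "const_section f n = (if n = 0 then f else (\<lambda>x s v. 0))"

definition compose_section :: "('a \<Rightarrow> 'v dual_endo) \<Rightarrow> ('a \<Rightarrow> 'v dual_endo) \<Rightarrow> 'a \<Rightarrow> 'v dual_endo" where
  "compose_section f g x = f x \<circ> g x"

definition formal_section_eq_on :: "('a, 'v::ab_group_add, 'd) hermitian_bundle \<Rightarrow> 'a set \<Rightarrow>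
    ('a, 'v) formal_section \<Rightarrow> ('a, 'v) formal_section \<Rightarrow> bool" where
  "formal_section_eq_on E U f g \<longleftrightarrow> (\<forall>n. \<forall>x\<in>U. \<forall>s\<in>dual_fibre E x. f n x s = g n x s)"

definition formal_matrix_in :: "('a, 'v::ab_group_add, 'd::finite) hermitian_bundle \<Rightarrow>
    ('d \<Rightarrow> 'a \<Rightarrow> 'v) \<Rightarrow> ('a, 'v) formal_section \<Rightarrow> 'a \<Rightarrow> complex fps^'d^'d" where
  "formal_matrix_in E e f x = (\<chi> i j. Abs_fps (\<lambda>n. matrix_in E e (f n) x $ i $ j))"

text \<open>The formula is \<open>((f u) * v * (g u)) u~\<close>, where \<open>u\<close> is the matrix of the
  metric, \<open>u~\<close> its pointwise inverse and \<open>v\<close> its inverse with respect to the star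
  product. As for functions, local sections are total maps whose values outside their domain are
  irrelevant.\<close>

definition is_bundle_star :: "('a::topological_space, 'n::finite) chart set \<Rightarrow> (nat \<Rightarrow> 'a biop) \<Rightarrow>
    ('a, 'v::ab_group_add, 'd::finite) hermitian_bundle \<Rightarrow>
    (('a, 'v) formal_section \<Rightarrow> ('a, 'v) formal_section \<Rightarrow> ('a, 'v) formal_section) \<Rightarrow> bool" where
  "is_bundle_star A C E star_u \<longleftrightarrow>
     (\<forall>U f g. open U \<longrightarrow> formal_smooth_section A E U f \<longrightarrow> formal_smooth_section A E U g \<longrightarrow>
        formal_smooth_section A E U (star_u f g) \<and>
        (\<forall>W e v. W \<subseteq> U \<longrightarrow> holomorphic_frame A E W e \<longrightarrow>
           is_star_inverse A C W (\<lambda>x. const_mat (metric_matrix E e x)) v \<longrightarrow>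
           (\<forall>x\<in>W. formal_matrix_in E e (star_u f g) x =
              mat_star C
                (mat_star C (\<lambda>y. formal_matrix_in E e f y ** const_mat (metric_matrix E e y)) v)
                (\<lambda>y. formal_matrix_in E e g y ** const_mat (metric_matrix E e y)) x
              ** const_mat (matrix_inv (metric_matrix E e x)))))"

end

theory Submission
  imports Defs
begin

text \<open>Where \<open>f\<close> is holomorphic, separation of variables gives \<open>f u = f \<star> u\<close>, so that
  \<open>(f u) \<star> v \<star> (g u) = f \<star> (u \<star> v) \<star> (g u) = f \<star> (g u) = f g u\<close>. Where \<open>h = u\<^sup>-\<^sup>1 g u\<close> is
  antiholomorphic, it gives \<open>g u = u h = u \<star> h\<close>, so that
  \<open>(f u) \<star> v \<star> (g u) = (f u) \<star> h = f u h = f g u\<close>. The bundle star product is only specified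
  through a star inverse \<open>v\<close> of the metric matrix \<open>u\<close>, so one has to be constructed: a right inverse
  is found order by order in \<open>\<nu>\<close>, and it is two-sided because it has a right inverse in turn.\<close>


subsection \<open>Functions of class $C^k$\<close>

text \<open>The obstacle is that functions and sections are total maps meaningful only on an open
  set. The identities used hold on a frame domain and not globally, so they cannot simply be
  rewritten under \<open>star\<close>. Replacing an argument there needs locality of every
  \<open>C r\<close>, and associativity for matrices needs additivity of every \<open>C r\<close>.
  Both are extracted from the coordinate form in \<open>bidifferential\<close>, a sum of products of
  iterated derivatives at one point; hence the calculus of C^k functions. The same calculus makes
  pointwise inverse matrices smooth, which is needed for the coefficients of \<open>v\<close> and
  for the conjugated matrix of g, since associativity and locality are available only for smooth
  arguments. The frame domain is the one supplied by the hypothesis on f or on g, so that holomorphy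
  or antiholomorphy holds on all of it.\<close>

lemma k_smooth_on_cong:
  assumes "open S" "\<And>z. z \<in> S \<Longrightarrow> F z = G z"
  shows "k_smooth_on k S F \<longleftrightarrow> k_smooth_on k S G"
  using assms(2)
proof (induction k arbitrary: F G)
  case 0
  then show ?case by (simp cong: continuous_on_cong)
next
  case (Suc k)
  \<comment> \<open>Openness of \<open>S\<close> makes F and G agree near z, so they have the same
    derivatives at z whatever their values outside \<open>S\<close>.\<close>
  have hd: "(F has_derivative D) (at z) \<longleftrightarrow> (G has_derivative D) (at z)" if "z \<in> S" for z D
    using has_derivative_transform_within_open[OF _ \<open>open S\<close> that, where t=UNIV] Suc.prems
    by metis
  have fd: "frechet_derivative F (at z) = frechet_derivative G (at z)" if "z \<in> S" for z
    unfolding frechet_derivative_def using hd[OF that] by simp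
  have "F differentiable (at z) \<longleftrightarrow> G differentiable (at z)" if "z \<in> S" for z
    unfolding differentiable_def using hd[OF that] by simp
  moreover have "k_smooth_on k S (\<lambda>z. frechet_derivative F (at z) w) \<longleftrightarrow>
      k_smooth_on k S (\<lambda>z. frechet_derivative G (at z) w)" for w
    by (rule Suc.IH) (simp add: fd)
  ultimately show ?case by auto
qed

lemma k_smooth_on_subset: "k_smooth_on k S F \<Longrightarrow> T \<subseteq> S \<Longrightarrow> k_smooth_on k T F"
proof (induction k arbitrary: F)
  case 0
  then show ?case by (auto intro: continuous_on_subset)
next
  case (Suc k)
  then show ?case by (simp add: subset_iff)
qed

text \<open>The product and inverse rules pair a derivative of order k with an undifferentiated
  factor, which has to be lowered to order k as well.\<close>

lemma k_smooth_on_Suc_D: "k_smooth_on (Suc k) S F \<Longrightarrow> k_smooth_on k S F"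
proof (induction k arbitrary: F)
  case 0
  then show ?case
    by (auto intro!: differentiable_imp_continuous_on differentiable_at_imp_differentiable_on)
next
  case (Suc k)
  then show ?case by auto
qed

lemma k_smooth_on_const: "k_smooth_on k S (\<lambda>_. c)"
  by (induction k arbitrary: c) auto

lemma frechet_derivative_add:
  "F differentiable (at z) \<Longrightarrow> G differentiable (at z) \<Longrightarrow>
    frechet_derivative (\<lambda>z. F z + G z) (at z) w =
      frechet_derivative F (at z) w + frechet_derivative G (at z) w"
  using frechet_derivative_at[OF has_derivative_add, of F "frechet_derivative F (at z)" z G
      "frechet_derivative G (at z)", symmetric]
  by (simp add: frechet_derivative_works)

lemma k_smooth_on_add:
  assumes "open S"
  shows "k_smooth_on k S F \<Longrightarrow> k_smooth_on k S G \<Longrightarrow> k_smooth_on k S (\<lambda>z. F z + G z)"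
proof (induction k arbitrary: F G)
  case 0
  then show ?case by (auto intro: continuous_on_add)
next
  case (Suc k)
  have "k_smooth_on k S (\<lambda>z. frechet_derivative (\<lambda>z. F z + G z) (at z) w) \<longleftrightarrow>
      k_smooth_on k S (\<lambda>z. frechet_derivative F (at z) w + frechet_derivative G (at z) w)" for w
    using Suc.prems by (intro k_smooth_on_cong[OF assms]) (auto simp: frechet_derivative_add)
  then show ?case using Suc by auto
qed

lemma k_smooth_on_mult:
  fixes F G :: "'b::real_normed_vector \<Rightarrow> 'c::real_normed_algebra"
  assumes "open S"
  shows "k_smooth_on k S F \<Longrightarrow> k_smooth_on k S G \<Longrightarrow> k_smooth_on k S (\<lambda>z. F z * G z)"
proof (induction k arbitrary: F G)
  case 0
  then show ?case by (auto intro: continuous_on_mult)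
next
  case (Suc k)
  have "frechet_derivative (\<lambda>z. F z * G z) (at z) w =
      F z * frechet_derivative G (at z) w + frechet_derivative F (at z) w * G z"
    if "z \<in> S" for z w
  proof -
    have "((\<lambda>z. F z * G z) has_derivative (\<lambda>w. F z * frechet_derivative G (at z) w
        + frechet_derivative F (at z) w * G z)) (at z)"
      using Suc.prems that by (intro has_derivative_mult) (auto simp: frechet_derivative_works)
    then show ?thesis by (simp add: frechet_derivative_at[symmetric])
  qed
  then have "k_smooth_on k S (\<lambda>z. frechet_derivative (\<lambda>z. F z * G z) (at z) w) \<longleftrightarrow>
      k_smooth_on k S (\<lambda>z. F z * frechet_derivative G (at z) w
        + frechet_derivative F (at z) w * G z)" for w
    by (intro k_smooth_on_cong[OF assms])
  moreover have "k_smooth_on k S (\<lambda>z. F z * frechet_derivative G (at z) w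
        + frechet_derivative F (at z) w * G z)" for w
    using Suc.prems by (intro k_smooth_on_add[OF assms] Suc.IH) (auto intro: k_smooth_on_Suc_D)
  ultimately show ?case using Suc.prems by auto
qed

lemma k_smooth_on_inverse:
  fixes F :: "'b::real_normed_vector \<Rightarrow> 'c::real_normed_field"
  assumes "open S" "\<And>z. z \<in> S \<Longrightarrow> F z \<noteq> 0"
  shows "k_smooth_on k S F \<Longrightarrow> k_smooth_on k S (\<lambda>z. inverse (F z))"
proof (induction k)
  case 0
  then show ?case using assms(2) by (auto intro: continuous_on_inverse)
next
  case (Suc k)
  have hd: "((\<lambda>z. inverse (F z)) has_derivative
      (\<lambda>w. - (inverse (F z) * frechet_derivative F (at z) w * inverse (F z)))) (at z)"
    if "z \<in> S" for z
    using Suc.prems that assms(2)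
    by (intro Deriv.has_derivative_inverse) (auto simp: frechet_derivative_works)
  have "k_smooth_on k S (\<lambda>z. frechet_derivative (\<lambda>z. inverse (F z)) (at z) w) \<longleftrightarrow>
      k_smooth_on k S (\<lambda>z. (-1) * (inverse (F z) * frechet_derivative F (at z) w * inverse (F z)))" for w
    by (intro k_smooth_on_cong[OF assms(1)]) (simp add: frechet_derivative_at[OF hd, symmetric])
  moreover have "k_smooth_on k S
      (\<lambda>z. (-1) * (inverse (F z) * frechet_derivative F (at z) w * inverse (F z)))" for w
    using Suc by (intro k_smooth_on_mult[OF assms(1)] k_smooth_on_const Suc.IH)
      (auto intro: k_smooth_on_Suc_D)
  moreover have "(\<lambda>z. inverse (F z)) differentiable (at z)" if "z \<in> S" for z
    using hd[OF that] by (auto simp: differentiable_def)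
  ultimately show ?case by auto
qed

lemma dirderivs_cong:
  assumes "open S" "\<And>z. z \<in> S \<Longrightarrow> F z = G z" "z \<in> S"
  shows "dirderivs bs F z = dirderivs bs G z"
  using assms(3)
proof (induction bs arbitrary: z)
  case (Cons b bs)
  have "(dirderivs bs F has_derivative D) (at z) \<longleftrightarrow> (dirderivs bs G has_derivative D) (at z)" for D
    using has_derivative_transform_within_open[OF _ \<open>open S\<close> Cons.prems, where t=UNIV] Cons.IH
    by metis
  then show ?case by (simp add: frechet_derivative_def)
qed (simp add: assms)

text \<open>Every differentiation costs one order, so the induction hypothesis is used at
  \<open>Suc k\<close>; this forces the premise to range over all orders.\<close>

lemma k_smooth_on_dirderivs:
  "(\<And>k. k_smooth_on k S F) \<Longrightarrow> k_smooth_on k S (dirderivs bs F)"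
proof (induction bs arbitrary: k)
  case (Cons b bs)
  then show ?case using k_smooth_on.simps(2)[of k S "dirderivs bs F"] by simp
qed simp

lemma dirderivs_add:
  assumes "open S" "\<And>k. k_smooth_on k S F" "\<And>k. k_smooth_on k S G" "z \<in> S"
  shows "dirderivs bs (\<lambda>z. F z + G z) z = dirderivs bs F z + dirderivs bs G z"
  using assms(4)
proof (induction bs arbitrary: z)
  case (Cons b bs)
  have "dirderivs bs F differentiable (at z)" "dirderivs bs G differentiable (at z)"
    using k_smooth_on_dirderivs[OF assms(2), of "Suc 0" bs]
      k_smooth_on_dirderivs[OF assms(3), of "Suc 0" bs] Cons.prems by auto
  then have "dirderivs (b # bs) F z + dirderivs (b # bs) G z =
      dirderivs [b] (\<lambda>z. dirderivs bs F z + dirderivs bs G z) z"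
    by (simp add: frechet_derivative_add)
  \<comment> \<open>Additivity of the inner derivatives is known on all of the open set
    \<open>S\<close>, not just at z, and may therefore be differentiated once more.\<close>
  also have "\<dots> = dirderivs [b] (dirderivs bs (\<lambda>z. F z + G z)) z"
    using Cons.IH by (intro dirderivs_cong[OF \<open>open S\<close> _ Cons.prems]) simp
  finally show ?case by simp
qed simp


subsection \<open>Smooth functions and bidifferential operators\<close>

lemma smooth_on_subset: "smooth_on A V f \<Longrightarrow> W \<subseteq> V \<Longrightarrow> smooth_on A W f"
  unfolding smooth_on_def by (blast intro: k_smooth_on_subset)

lemma smooth_on_const: "smooth_on A V (\<lambda>_. c)"
  by (auto simp: smooth_on_def local_rep_def o_def k_smooth_on_const)

lemma
  fixes M :: "'k::semiring_1^'m^'n"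
  assumes "invertible M"
  shows matrix_inv_right: "M ** matrix_inv M = mat 1"
    and matrix_inv_left: "matrix_inv M ** M = mat 1"
  using assms someI_ex[of "\<lambda>M'. M ** M' = mat 1 \<and> M' ** M = mat 1"]
  unfolding invertible_def matrix_inv_def by blast+

context complex_manifold
begin

lemma chart_inv_into: "(W, \<phi>) \<in> A \<Longrightarrow> x \<in> W \<Longrightarrow> inv_into W \<phi> (\<phi> x) = x"
  using chart_homeomorphism unfolding homeomorphism_def by blast

lemma open_chart_image:
  assumes "(W, \<phi>) \<in> A" "open V"
  shows "open (\<phi> ` (W \<inter> V))"
proof -
  have "openin (top_of_set (\<phi> ` W)) (\<phi> ` (W \<inter> V))"
    using chart_homeomorphism[OF assms(1)] assms(2)
    by (intro homeomorphism_imp_open_map) auto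
  then show ?thesis using chart_open[OF assms(1)] openin_open_trans by blast
qed

lemma smooth_on_cong:
  assumes "open V" "\<And>x. x \<in> V \<Longrightarrow> f x = g x"
  shows "smooth_on A V f \<longleftrightarrow> smooth_on A V g"
proof -
  have "k_smooth_on k (\<phi> ` (W \<inter> V)) (local_rep (W, \<phi>) f) \<longleftrightarrow>
      k_smooth_on k (\<phi> ` (W \<inter> V)) (local_rep (W, \<phi>) g)" if "(W, \<phi>) \<in> A" for W \<phi> k
    using assms that
    by (intro k_smooth_on_cong open_chart_image) (auto simp: local_rep_def chart_inv_into)
  then show ?thesis unfolding smooth_on_def by fast
qed

lemma smooth_on_add:
  "open V \<Longrightarrow> smooth_on A V f \<Longrightarrow> smooth_on A V g \<Longrightarrow> smooth_on A V (\<lambda>x. f x + g x)"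
  by (auto simp: smooth_on_def local_rep_def o_def intro!: k_smooth_on_add open_chart_image)

lemma smooth_on_mult:
  "open V \<Longrightarrow> smooth_on A V f \<Longrightarrow> smooth_on A V g \<Longrightarrow> smooth_on A V (\<lambda>x. f x * g x)"
  by (auto simp: smooth_on_def local_rep_def o_def intro!: k_smooth_on_mult open_chart_image)

lemma smooth_on_diff:
  assumes "open V" "smooth_on A V f" "smooth_on A V g"
  shows "smooth_on A V (\<lambda>x. f x - g x)"
  using smooth_on_add[OF assms(1,2) smooth_on_mult[OF assms(1) smooth_on_const assms(3), of "- 1"]]
  by simp

lemma smooth_on_sum:
  "open V \<Longrightarrow> (\<And>i. i \<in> I \<Longrightarrow> smooth_on A V (f i)) \<Longrightarrow> smooth_on A V (\<lambda>x. \<Sum>i\<in>I. f i x)"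
  by (induction I rule: infinite_finite_induct) (auto intro: smooth_on_const smooth_on_add)

lemma smooth_on_prod:
  "open V \<Longrightarrow> (\<And>i. i \<in> I \<Longrightarrow> smooth_on A V (f i)) \<Longrightarrow> smooth_on A V (\<lambda>x. \<Prod>i\<in>I. f i x)"
  by (induction I rule: infinite_finite_induct) (auto intro: smooth_on_const smooth_on_mult)

lemma smooth_on_inverse:
  assumes "open V" "smooth_on A V f" "\<And>x. x \<in> V \<Longrightarrow> f x \<noteq> 0"
  shows "smooth_on A V (\<lambda>x. inverse (f x))"
proof -
  have "k_smooth_on k (\<phi> ` (W \<inter> V)) (\<lambda>z. inverse (local_rep (W, \<phi>) f z))"
    if "(W, \<phi>) \<in> A" for W \<phi> k
    using assms that
    by (intro k_smooth_on_inverse open_chart_image)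
      (auto simp: local_rep_def o_def chart_inv_into smooth_on_def)
  then show ?thesis by (auto simp: smooth_on_def local_rep_def o_def)
qed

lemma smooth_on_det:
  assumes "open V" "\<And>i j. smooth_on A V (\<lambda>x. M x $ i $ j)"
  shows "smooth_on A V (\<lambda>x. det (M x))"
  unfolding det_def
  by (intro smooth_on_sum smooth_on_mult smooth_on_prod smooth_on_const assms)

lemma smooth_on_matrix_mult:
  assumes "open V" "\<And>i j. smooth_on A V (\<lambda>x. M x $ i $ j)" "\<And>i j. smooth_on A V (\<lambda>x. N x $ i $ j)"
  shows "smooth_on A V (\<lambda>x. (M x ** N x) $ i $ j)"
  by (simp add: matrix_matrix_mult_def smooth_on_sum smooth_on_mult assms)

text \<open>By Cramer's rule each entry of the inverse is a quotient of determinants, and these are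
  polynomials in the entries of \<open>M\<close>.\<close>

lemma smooth_on_matrix_inv:
  fixes M :: "'a \<Rightarrow> complex^'d^'d"
  assumes V: "open V" and M: "\<And>i j. smooth_on A V (\<lambda>x. M x $ i $ j)"
    and inv: "\<And>x. x \<in> V \<Longrightarrow> invertible (M x)"
  shows "smooth_on A V (\<lambda>x. matrix_inv (M x) $ i $ j)"
proof -
  \<comment> \<open>\<open>N x\<close> is \<open>M x\<close> with its column i replaced by the j-th
    unit column, which is the image under \<open>M x\<close> of column j of the inverse.\<close>
  define N :: "'a \<Rightarrow> complex^'d^'d"
    where "N x = (\<chi> k l. if l = i then mat 1 $ k $ j else M x $ k $ l)" for x
  have eq: "matrix_inv (M x) $ i $ j = det (N x) * inverse (det (M x))" if "x \<in> V" for x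
  proof -
    define c where "c = (\<chi> k. matrix_inv (M x) $ k $ j)"
    have "(M x *v c) $ k = (M x ** matrix_inv (M x)) $ k $ j" for k
      by (simp add: matrix_vector_mult_def matrix_matrix_mult_def c_def)
    then have "(M x *v c) $ k = mat 1 $ k $ j" for k
      by (simp add: matrix_inv_right inv that)
    then have "det (N x) = c $ i * det (M x)"
      unfolding cramer_lemma[symmetric] N_def by presburger
    then show ?thesis using inv[OF that] by (simp add: c_def invertible_det_nz)
  qed
  have "smooth_on A V (\<lambda>x. N x $ k $ l)" for k l
    by (cases "l = i") (simp_all add: N_def M smooth_on_const)
  then have "smooth_on A V (\<lambda>x. det (N x) * inverse (det (M x)))"
    using inv by (intro smooth_on_mult smooth_on_inverse smooth_on_det V M)
      (auto simp: invertible_det_nz)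
  then show ?thesis by (subst smooth_on_cong[OF V eq])
qed

text \<open>Hides the chart behind the three facts that locality and additivity use. The
  coefficients \<open>c\<close> become plain numbers because only the value at x matters; T is the
  chart image of the part of V on which the coordinate formula holds.\<close>

lemma bidifferential_local_form:
  assumes "bidifferential A B" "open V" "x \<in> V"
  obtains S :: "('a, 'n) chart" and T z N c where "open T" "z \<in> T"
    "\<And>f k. smooth_on A V f \<Longrightarrow> k_smooth_on k T (local_rep S f)"
    "\<And>f g w. (\<And>y. y \<in> V \<Longrightarrow> f y = g y) \<Longrightarrow> w \<in> T \<Longrightarrow> local_rep S f w = local_rep S g w"
    "\<And>f g. smooth_on A V f \<Longrightarrow> smooth_on A V g \<Longrightarrow> B f g x =
      (\<Sum>\<alpha>\<in>multi_indices N. \<Sum>\<beta>\<in>multi_indices N.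
        c \<alpha> \<beta> * dirderivs \<alpha> (local_rep S f) z * dirderivs \<beta> (local_rep S g) z)"
proof -
  obtain V0 \<phi> W N c where W: "(V0, \<phi>) \<in> A" "open W" "x \<in> W" "W \<subseteq> V0"
    "\<forall>W' f g. open W' \<longrightarrow> W' \<subseteq> W \<longrightarrow> smooth_on A W' f \<longrightarrow> smooth_on A W' g \<longrightarrow>
          (\<forall>x\<in>W'. B f g x =
             (\<Sum>\<alpha>\<in>multi_indices N. \<Sum>\<beta>\<in>multi_indices N.
                c \<alpha> \<beta> x * dirderivs \<alpha> (local_rep (V0, \<phi>) f) (\<phi> x)
                        * dirderivs \<beta> (local_rep (V0, \<phi>) g) (\<phi> x)))"
    using assms(1)[unfolded bidifferential_def, THEN conjunct2, THEN spec[of _ x]]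
    by (elim bexE case_prodE exE conjE) (rule that; simp)
  let ?T = "\<phi> ` (V0 \<inter> (W \<inter> V))"
  show thesis
  proof (rule that[where T="?T" and z="\<phi> x" and S="(V0, \<phi>)" and N=N and c="\<lambda>\<alpha> \<beta>. c \<alpha> \<beta> x"])
    show "open ?T" using W(1,2) assms(2) by (intro open_chart_image) auto
    show "\<phi> x \<in> ?T" using W assms(3) by auto
    show "k_smooth_on k ?T (local_rep (V0, \<phi>) f)" if "smooth_on A V f" for f k
      using smooth_on_subset[OF that, of "W \<inter> V"] W(1) by (auto simp: smooth_on_def)
    show "local_rep (V0, \<phi>) f w = local_rep (V0, \<phi>) g w"
      if "\<And>y. y \<in> V \<Longrightarrow> f y = g y" "w \<in> ?T" for f g w
      using that W(1) by (auto simp: local_rep_def chart_inv_into)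
    show "B f g x = (\<Sum>\<alpha>\<in>multi_indices N. \<Sum>\<beta>\<in>multi_indices N.
        c \<alpha> \<beta> x * dirderivs \<alpha> (local_rep (V0, \<phi>) f) (\<phi> x) * dirderivs \<beta> (local_rep (V0, \<phi>) g) (\<phi> x))"
      if "smooth_on A V f" "smooth_on A V g" for f g
      using W(5)[rule_format, of "W \<inter> V" f g x] W(2,3) assms(2,3)
        smooth_on_subset[OF that(1), of "W \<inter> V"] smooth_on_subset[OF that(2), of "W \<inter> V"]
      by auto
  qed
qed

text \<open>Locality: the local form sees its arguments only through derivatives at one point, and
  these depend only on germs.\<close>

lemma bidifferential_cong:
  assumes "bidifferential A B" "open V" "smooth_on A V f" "smooth_on A V g"
    "\<And>y. y \<in> V \<Longrightarrow> f y = f' y" "\<And>y. y \<in> V \<Longrightarrow> g y = g' y" "x \<in> V"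
  shows "B f g x = B f' g' x"
proof -
  have smooth': "smooth_on A V f'" "smooth_on A V g'"
    using assms smooth_on_cong by blast+
  obtain S :: "('a, 'n) chart" and T z N c where T: "open T" "z \<in> T"
    "\<And>f g w. (\<And>y. y \<in> V \<Longrightarrow> f y = g y) \<Longrightarrow> w \<in> T \<Longrightarrow> local_rep S f w = local_rep S g w"
    "\<And>f g. smooth_on A V f \<Longrightarrow> smooth_on A V g \<Longrightarrow> B f g x =
      (\<Sum>\<alpha>\<in>multi_indices N. \<Sum>\<beta>\<in>multi_indices N.
        c \<alpha> \<beta> * dirderivs \<alpha> (local_rep S f) z * dirderivs \<beta> (local_rep S g) z)"
    by (rule bidifferential_local_form[OF assms(1,2,7)]) blast
  have "dirderivs bs (local_rep S f) z = dirderivs bs (local_rep S f') z"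
    "dirderivs bs (local_rep S g) z = dirderivs bs (local_rep S g') z" for bs
    using T(3)[OF assms(5)] T(3)[OF assms(6)] by (auto intro: dirderivs_cong[OF T(1) _ T(2)])
  then show ?thesis by (simp add: T(4) assms(3,4) smooth')
qed

text \<open>Inherited from the additivity of each iterated derivative in the local form.\<close>

lemma bidifferential_add:
  assumes "bidifferential A B" "open V" "smooth_on A V f" "smooth_on A V f'" "smooth_on A V g" "x \<in> V"
  shows bidifferential_add_left: "B (\<lambda>y. f y + f' y) g x = B f g x + B f' g x"
    and bidifferential_add_right: "B g (\<lambda>y. f y + f' y) x = B g f x + B g f' x"
proof -
  obtain S :: "('a, 'n) chart" and T z N c where T: "open T" "z \<in> T"
    "\<And>f k. smooth_on A V f \<Longrightarrow> k_smooth_on k T (local_rep S f)"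
    "\<And>f g. smooth_on A V f \<Longrightarrow> smooth_on A V g \<Longrightarrow> B f g x =
      (\<Sum>\<alpha>\<in>multi_indices N. \<Sum>\<beta>\<in>multi_indices N.
        c \<alpha> \<beta> * dirderivs \<alpha> (local_rep S f) z * dirderivs \<beta> (local_rep S g) z)"
    by (rule bidifferential_local_form[OF assms(1,2,6)]) blast
  have "local_rep S (\<lambda>y. f y + f' y) = (\<lambda>w. local_rep S f w + local_rep S f' w)"
    by (simp add: local_rep_def o_def)
  then have "dirderivs bs (local_rep S (\<lambda>y. f y + f' y)) z =
      dirderivs bs (local_rep S f) z + dirderivs bs (local_rep S f') z" for bs
    using dirderivs_add[OF T(1) T(3)[OF assms(3)] T(3)[OF assms(4)] T(2)] by simp
  then show "B (\<lambda>y. f y + f' y) g x = B f g x + B f' g x"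
    "B g (\<lambda>y. f y + f' y) x = B g f x + B g f' x"
    by (simp_all add: T(4) assms(2-5) smooth_on_add sum.distrib algebra_simps)
qed

lemma bidifferential_zero:
  assumes "bidifferential A B" "open V" "smooth_on A V g" "x \<in> V"
  shows bidifferential_zero_left: "B (\<lambda>_. 0) g x = 0"
    and bidifferential_zero_right: "B g (\<lambda>_. 0) x = 0"
  \<comment> \<open>With both summands zero, additivity reads b = b + b.\<close>
  using bidifferential_add[OF assms(1,2) smooth_on_const[of _ _ 0] smooth_on_const[of _ _ 0] assms(3,4)]
  by simp_all

lemma bidifferential_sum:
  assumes "bidifferential A B" "open V" "\<And>i. i \<in> I \<Longrightarrow> smooth_on A V (f i)" "smooth_on A V g" "x \<in> V"
  shows bidifferential_sum_left: "B (\<lambda>y. \<Sum>i\<in>I. f i y) g x = (\<Sum>i\<in>I. B (f i) g x)"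
    and bidifferential_sum_right: "B g (\<lambda>y. \<Sum>i\<in>I. f i y) x = (\<Sum>i\<in>I. B g (f i) x)"
  using assms(3)
  by (induction I rule: infinite_finite_induct)
    (simp_all add: bidifferential_zero[OF assms(1,2,4,5)] smooth_on_sum[OF assms(2)]
      bidifferential_add[OF assms(1,2) _ _ assms(4,5)])

end


subsection \<open>The star product of matrices\<close>

definition smooth_matrix_on ::
  "('a, 'n::finite) chart set \<Rightarrow> 'a set \<Rightarrow> ('a \<Rightarrow> complex fps^'d^'d) \<Rightarrow> bool" where
  "smooth_matrix_on A V F \<longleftrightarrow> (\<forall>i j. formal_smooth_on A V (\<lambda>x. F x $ i $ j))"

text \<open>The classical limit of a formal matrix; its pointwise invertibility is the condition
  under which a star inverse is constructed.\<close>

definition leading_matrix :: "complex fps^'d^'d \<Rightarrow> complex^'d^'d" where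
  "leading_matrix M = (\<chi> i j. fps_nth (M $ i $ j) 0)"

lemma sum_fps_const: "(\<Sum>i\<in>I. fps_const (f i)) = fps_const (\<Sum>i\<in>I. f i)"
  by (simp add: fps_eq_iff fps_sum_nth)

lemma const_mat_mult: "const_mat (M ** N) = const_mat M ** const_mat N"
  by (simp add: const_mat_def matrix_matrix_mult_def vec_eq_iff sum_fps_const)

lemma coef_const_mat_entry:
  "coef (\<lambda>y. const_mat (M y) $ i $ j) n = (if n = 0 then \<lambda>y. M y $ i $ j else (\<lambda>_. 0))"
  by (simp add: coef_def const_mat_def fun_eq_iff)

lemma smooth_matrix_on_const_mat:
  "(\<And>i j. smooth_on A V (\<lambda>x. M x $ i $ j)) \<Longrightarrow> smooth_matrix_on A V (\<lambda>x. const_mat (M x))"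
  by (simp add: smooth_matrix_on_def formal_smooth_on_def coef_const_mat_entry smooth_on_const)

lemma leading_matrix_const_mat: "leading_matrix (const_mat M) = M"
  by (simp add: leading_matrix_def const_mat_def vec_eq_iff)

text \<open>Comparing coefficients of \<open>\<nu>\<^sup>n\<close> in \<open>F \<star> v = 1\<close>, where \<open>C\<^sub>0\<close> is the pointwise product, and
  solving for \<open>v\<^sub>n\<close>.\<close>

function star_right_inverse_coef ::
  "(nat \<Rightarrow> 'a biop) \<Rightarrow> ('a \<Rightarrow> complex fps^'d^'d) \<Rightarrow> nat \<Rightarrow> 'a \<Rightarrow> complex^'d^'d" where
  "star_right_inverse_coef C F n x = matrix_inv (leading_matrix (F x)) **
     ((if n = 0 then mat 1 else 0) -
      (\<chi> i j. \<Sum>k\<in>UNIV. \<Sum>r\<le>n. \<Sum>s\<le>n - r. if r = 0 \<and> s = 0 then 0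
         else C r (coef (\<lambda>y. F y $ i $ k) s)
           (\<lambda>y. star_right_inverse_coef C F (n - r - s) y $ k $ j) x))"
  by auto
text \<open>The guard gives r + s > 0 and the summation ranges give r + s \<le> n, so n - r - s < n.
  The ranges matter: at n = 0 truncated subtraction alone would not decrease.\<close>

termination by (relation "Wellfounded.measure (\<lambda>(C, F, n, x). n)") auto

declare star_right_inverse_coef.simps [simp del]

definition star_right_inverse ::
  "(nat \<Rightarrow> 'a biop) \<Rightarrow> ('a \<Rightarrow> complex fps^'d^'d) \<Rightarrow> 'a \<Rightarrow> complex fps^'d^'d" where
  "star_right_inverse C F x = (\<chi> i j. Abs_fps (\<lambda>n. star_right_inverse_coef C F n x $ i $ j))"

context star_product
begin

lemma C_smooth: "open V \<Longrightarrow> smooth_on A V f \<Longrightarrow> smooth_on A V g \<Longrightarrow> smooth_on A V (C r f g)"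
  using C_bidifferential unfolding bidifferential_def by blast

lemma formal_smooth_on_sum:
  assumes "open V" "\<And>i. i \<in> I \<Longrightarrow> formal_smooth_on A V (F i)"
  shows "formal_smooth_on A V (\<lambda>x. \<Sum>i\<in>I. F i x)"
proof -
  have "coef (\<lambda>x. \<Sum>i\<in>I. F i x) n = (\<lambda>x. \<Sum>i\<in>I. coef (F i) n x)" for n
    by (simp add: coef_def fps_sum_nth fun_eq_iff)
  then show ?thesis using assms by (simp add: formal_smooth_on_def smooth_on_sum)
qed

lemma formal_smooth_on_star:
  assumes "open V" "formal_smooth_on A V F" "formal_smooth_on A V G"
  shows "formal_smooth_on A V (star C F G)"
proof -
  have "coef (star C F G) n = (\<lambda>x. \<Sum>r\<le>n. \<Sum>s\<le>n - r. C r (coef F s) (coef G (n - r - s)) x)" for n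
    by (simp add: coef_def star_def fun_eq_iff)
  then show ?thesis
    using assms by (auto simp: formal_smooth_on_def intro!: smooth_on_sum C_smooth)
qed

lemma star_cong:
  assumes V: "open V" "formal_smooth_on A V F" "formal_smooth_on A V G"
    and "\<And>y. y \<in> V \<Longrightarrow> F y = F' y" "\<And>y. y \<in> V \<Longrightarrow> G y = G' y" "x \<in> V"
  shows "star C F G x = star C F' G' x"
proof -
  have "C r (coef F s) (coef G t) x = C r (coef F' s) (coef G' t) x" for r s t
    using assms
    by (intro bidifferential_cong[OF C_bidifferential V(1)]) (auto simp: formal_smooth_on_def coef_def)
  then show ?thesis by (simp add: star_def)
qed

lemma star_sum:
  assumes V: "open V" "\<And>i. i \<in> I \<Longrightarrow> formal_smooth_on A V (F i)" "formal_smooth_on A V G" "x \<in> V"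
  shows star_sum_left: "star C (\<lambda>y. \<Sum>i\<in>I. F i y) G x = (\<Sum>i\<in>I. star C (F i) G x)"
    and star_sum_right: "star C G (\<lambda>y. \<Sum>i\<in>I. F i y) x = (\<Sum>i\<in>I. star C G (F i) x)"
proof -
  have coef_sum: "coef (\<lambda>x. \<Sum>i\<in>I. F i x) n = (\<lambda>x. \<Sum>i\<in>I. coef (F i) n x)" for n
    by (simp add: coef_def fps_sum_nth fun_eq_iff)
  have swap: "(\<Sum>r\<le>n. \<Sum>s\<le>n - r. \<Sum>i\<in>I. T i r s) = (\<Sum>i\<in>I. \<Sum>r\<le>n. \<Sum>s\<le>n - r. T i r s)"
    for T :: "_ \<Rightarrow> nat \<Rightarrow> nat \<Rightarrow> complex" and n
  proof -
    have "(\<Sum>r\<le>n. \<Sum>s\<le>n - r. \<Sum>i\<in>I. T i r s) = (\<Sum>r\<le>n. \<Sum>i\<in>I. \<Sum>s\<le>n - r. T i r s)"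
      by (intro sum.cong refl sum.swap)
    also have "\<dots> = (\<Sum>i\<in>I. \<Sum>r\<le>n. \<Sum>s\<le>n - r. T i r s)"
      by (rule sum.swap)
    finally show ?thesis .
  qed
  have "C r (\<lambda>x. \<Sum>i\<in>I. coef (F i) s x) (coef G t) x = (\<Sum>i\<in>I. C r (coef (F i) s) (coef G t) x)"
    "C r (coef G t) (\<lambda>x. \<Sum>i\<in>I. coef (F i) s x) x = (\<Sum>i\<in>I. C r (coef G t) (coef (F i) s) x)"
    for r s t
    using V(2,3) by (auto simp: formal_smooth_on_def
        intro!: bidifferential_sum[OF C_bidifferential V(1) _ _ V(4)])
  then show "star C (\<lambda>y. \<Sum>i\<in>I. F i y) G x = (\<Sum>i\<in>I. star C (F i) G x)"
    "star C G (\<lambda>y. \<Sum>i\<in>I. F i y) x = (\<Sum>i\<in>I. star C G (F i) x)"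
    by (simp_all add: fps_eq_iff star_def fps_sum_nth coef_sum swap)
qed

lemma mat_star_nth:
  "fps_nth (mat_star C F G x $ i $ j) n = (\<Sum>k\<in>UNIV. \<Sum>r\<le>n. \<Sum>s\<le>n - r.
     C r (coef (\<lambda>y. F y $ i $ k) s) (coef (\<lambda>y. G y $ k $ j) (n - r - s)) x)"
  by (simp add: mat_star_def star_def fps_sum_nth)

lemma smooth_matrix_on_mat_star:
  "open V \<Longrightarrow> smooth_matrix_on A V F \<Longrightarrow> smooth_matrix_on A V G \<Longrightarrow>
    smooth_matrix_on A V (mat_star C F G)"
  by (simp add: smooth_matrix_on_def mat_star_def formal_smooth_on_sum formal_smooth_on_star)

lemma mat_star_cong:
  assumes "open V" "smooth_matrix_on A V F" "smooth_matrix_on A V G"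
    "\<And>y. y \<in> V \<Longrightarrow> F y = F' y" "\<And>y. y \<in> V \<Longrightarrow> G y = G' y" "x \<in> V"
  shows "mat_star C F G x = mat_star C F' G' x"
  using assms unfolding mat_star_def smooth_matrix_on_def
  by (auto simp: vec_eq_iff intro!: sum.cong star_cong[OF assms(1)])

text \<open>Associativity of the scalar product is not enough: the inner matrix product is a sum
  inside an argument of \<open>star\<close>, so additivity must pull it out before
  \<open>star_assoc\<close> applies, and the two sums are then exchanged.\<close>

lemma mat_star_assoc:
  assumes V: "open V" "smooth_matrix_on A V F" "smooth_matrix_on A V G" "smooth_matrix_on A V H" "x \<in> V"
  shows "mat_star C (mat_star C F G) H x = mat_star C F (mat_star C G H) x"
proof -
  have s: "formal_smooth_on A V (\<lambda>y. F y $ i $ j)" "formal_smooth_on A V (\<lambda>y. G y $ i $ j)"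
    "formal_smooth_on A V (\<lambda>y. H y $ i $ j)" for i j
    using V by (simp_all add: smooth_matrix_on_def)
  have "mat_star C (mat_star C F G) H x $ i $ j = mat_star C F (mat_star C G H) x $ i $ j" for i j
  proof -
    have "mat_star C (mat_star C F G) H x $ i $ j = (\<Sum>k\<in>UNIV. \<Sum>l\<in>UNIV.
        star C (star C (\<lambda>y. F y $ i $ l) (\<lambda>y. G y $ l $ k)) (\<lambda>y. H y $ k $ j) x)"
      by (simp add: mat_star_def star_sum_left[OF V(1) _ _ V(5)] s formal_smooth_on_star V(1))
    also have "\<dots> = (\<Sum>k\<in>UNIV. \<Sum>l\<in>UNIV.
        star C (\<lambda>y. F y $ i $ l) (star C (\<lambda>y. G y $ l $ k) (\<lambda>y. H y $ k $ j)) x)"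
      by (simp add: star_assoc[OF V(1) _ _ _ V(5)] s)
    also have "\<dots> = (\<Sum>l\<in>UNIV. \<Sum>k\<in>UNIV.
        star C (\<lambda>y. F y $ i $ l) (star C (\<lambda>y. G y $ l $ k) (\<lambda>y. H y $ k $ j)) x)"
      by (rule sum.swap)
    also have "\<dots> = mat_star C F (mat_star C G H) x $ i $ j"
      by (simp add: mat_star_def star_sum_right[OF V(1) _ _ V(5)] s formal_smooth_on_star V(1))
    finally show ?thesis .
  qed
  then show ?thesis by (simp add: vec_eq_iff)
qed

lemma mat_star_1:
  assumes V: "open V" "smooth_matrix_on A V F" "x \<in> V"
  shows mat_star_1_left: "mat_star C (\<lambda>_. mat 1) F x = F x"
    and mat_star_1_right: "mat_star C F (\<lambda>_. mat 1) x = F x"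
proof -
  have s: "formal_smooth_on A V (\<lambda>y. F y $ i $ j)" for i j
    using V by (simp add: smooth_matrix_on_def)
  \<comment> \<open>The off-diagonal entries of \<open>mat 1\<close> contribute nothing: a star
    product with 0 is additivity over the empty index set.\<close>
  have "star C (\<lambda>y. 0) (\<lambda>y. F y $ i $ j) x = 0" "star C (\<lambda>y. F y $ i $ j) (\<lambda>y. 0) x = 0" for i j
    using star_sum[OF V(1) _ s V(3), of "{}"] by simp_all
  then have "star C (\<lambda>y. mat 1 $ i $ k) (\<lambda>y. F y $ k $ j) x = (if i = k then F x $ k $ j else 0)"
    "star C (\<lambda>y. F y $ i $ k) (\<lambda>y. mat 1 $ k $ j) x = (if k = j then F x $ i $ k else 0)" for i j k
    using star_unit[OF V(1) s V(3)] by (simp_all add: mat_def)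
  then show "mat_star C (\<lambda>_. mat 1) F x = F x" "mat_star C F (\<lambda>_. mat 1) x = F x"
    by (simp_all add: mat_star_def vec_eq_iff)
qed

section \<open>Existence of star inverses of matrices with invertible leading term\<close>

lemma smooth_star_right_inverse_coef:
  fixes F :: "'a \<Rightarrow> complex fps^'d^'d"
  assumes V: "open V" "smooth_matrix_on A V F"
    and inv: "\<And>x. x \<in> V \<Longrightarrow> invertible (leading_matrix (F x))"
  shows "smooth_on A V (\<lambda>x. star_right_inverse_coef C F n x $ i $ j)"
proof (induction n arbitrary: i j rule: less_induct)
  case (less n)
  have F: "smooth_on A V (coef (\<lambda>y. F y $ i $ j) s)" for i j s
    using V(2) by (simp add: smooth_matrix_on_def formal_smooth_on_def)
  from F[of _ _ 0] have lead: "smooth_on A V (\<lambda>x. leading_matrix (F x) $ i $ j)" for i j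
    by (simp add: leading_matrix_def coef_def[abs_def])
  \<comment> \<open>Away from r = s = 0 the term involves only a coefficient of index below n, to
    which the induction hypothesis applies.\<close>
  have rest: "smooth_on A V (\<lambda>x. if r = 0 \<and> s = 0 then 0 else C r (coef (\<lambda>y. F y $ i $ k) s)
      (\<lambda>y. star_right_inverse_coef C F (n - r - s) y $ k $ j) x)"
    if "r \<le> n" "s \<le> n - r" for r s i j k
    using that by (cases "r = 0 \<and> s = 0") (auto intro!: smooth_on_const C_smooth[OF V(1) F less])
  have "smooth_on A V (\<lambda>x. ((if n = 0 then mat 1 else 0) -
      (\<chi> i j. \<Sum>k\<in>UNIV. \<Sum>r\<le>n. \<Sum>s\<le>n - r. if r = 0 \<and> s = 0 then 0
         else C r (coef (\<lambda>y. F y $ i $ k) s)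
           (\<lambda>y. star_right_inverse_coef C F (n - r - s) y $ k $ j) x)) $ i $ j)" for i j
    unfolding vector_minus_component vec_lambda_beta
    by (intro smooth_on_diff smooth_on_sum V(1) smooth_on_const rest) simp_all
  then show ?case
    unfolding star_right_inverse_coef.simps[of C F n]
    by (intro smooth_on_matrix_mult smooth_on_matrix_inv V(1) lead inv)
qed

lemma coef_star_right_inverse:
  "coef (\<lambda>y. star_right_inverse C F y $ i $ j) n = (\<lambda>y. star_right_inverse_coef C F n y $ i $ j)"
  by (simp add: coef_def star_right_inverse_def fun_eq_iff)

text \<open>In the coefficient of order n the unknown of index n occurs only for r = s = 0,
  multiplied pointwise by the leading matrix; the recursion was solved for exactly this
  product.\<close>

lemma mat_star_right_inverse:
  fixes F :: "'a \<Rightarrow> complex fps^'d^'d"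
  assumes V: "open V" "smooth_matrix_on A V F" "x \<in> V"
    and inv: "\<And>x. x \<in> V \<Longrightarrow> invertible (leading_matrix (F x))"
  shows "mat_star C F (star_right_inverse C F) x = mat 1"
proof -
  let ?R = "star_right_inverse_coef C F"
  define T where "T i j k n r s = C r (coef (\<lambda>y. F y $ i $ k) s) (\<lambda>y. ?R (n - r - s) y $ k $ j) x"
    for i j k :: 'd and n r s
  have split: "(\<Sum>r\<le>n. \<Sum>s\<le>n - r. t r s) = t 0 0 + (\<Sum>r\<le>n. \<Sum>s\<le>n - r. if r = 0 \<and> s = 0 then 0 else t r s)"
    for t :: "nat \<Rightarrow> nat \<Rightarrow> complex" and n
  proof -
    have "(\<Sum>r\<le>n. \<Sum>s\<le>n - r. t r s) = (\<Sum>r\<le>n. \<Sum>s\<le>n - r.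
        (if r = 0 then if s = 0 then t 0 0 else 0 else 0) + (if r = 0 \<and> s = 0 then 0 else t r s))"
      by (intro sum.cong) auto
    also have "\<dots> = (\<Sum>r\<le>n. if r = 0 then \<Sum>s\<le>n - r. if s = 0 then t 0 0 else 0 else 0) +
        (\<Sum>r\<le>n. \<Sum>s\<le>n - r. if r = 0 \<and> s = 0 then 0 else t r s)"
      unfolding sum.distrib by (intro arg_cong2[where f="(+)"] sum.cong) auto
    finally show ?thesis by simp
  qed
  \<comment> \<open>\<open>C_0\<close> speaks only of smooth arguments, so smoothness of the
    coefficients has to be known before they are shown to form an inverse.\<close>
  have T0: "T i j k n 0 0 = leading_matrix (F x) $ i $ k * ?R n x $ k $ j" for i j k n
    using V(2) smooth_star_right_inverse_coef[OF V(1,2) inv]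
    by (simp add: T_def C_0[OF V(1) _ _ V(3)] smooth_matrix_on_def formal_smooth_on_def)
      (simp add: coef_def leading_matrix_def)
  have "(\<Sum>k\<in>UNIV. \<Sum>r\<le>n. \<Sum>s\<le>n - r. T i j k n r s) = (if n = 0 then mat 1 else 0) $ i $ j"
    for i j n
  proof -
    let ?X = "\<lambda>k. \<Sum>r\<le>n. \<Sum>s\<le>n - r. if r = 0 \<and> s = 0 then 0 else T i j k n r s"
    have "(\<Sum>k\<in>UNIV. \<Sum>r\<le>n. \<Sum>s\<le>n - r. T i j k n r s) = (\<Sum>k\<in>UNIV. T i j k n 0 0 + ?X k)"
      by (intro sum.cong refl split)
    also have "\<dots> = (leading_matrix (F x) ** ?R n x) $ i $ j + (\<Sum>k\<in>UNIV. ?X k)"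
      by (simp add: T0 sum.distrib matrix_matrix_mult_def)
    also have "(leading_matrix (F x) ** ?R n x) $ i $ j =
        (if n = 0 then mat 1 else 0) $ i $ j - (\<Sum>k\<in>UNIV. ?X k)"
      unfolding star_right_inverse_coef.simps[of C F n] T_def
      by (simp add: matrix_mul_assoc matrix_inv_right inv[OF V(3)])
    finally show ?thesis by simp
  qed
  then have "fps_nth (mat_star C F (star_right_inverse C F) x $ i $ j) n = fps_nth (mat 1 $ i $ j) n" for i j n
    unfolding mat_star_nth coef_star_right_inverse T_def by (simp add: mat_def)
  then show ?thesis by (simp add: vec_eq_iff fps_eq_iff)
qed

lemma star_inverse_exists:
  fixes F :: "'a \<Rightarrow> complex fps^'d^'d"
  assumes V: "open V" "smooth_matrix_on A V F"
    and inv: "\<And>x. x \<in> V \<Longrightarrow> invertible (leading_matrix (F x))"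
  shows "\<exists>v. is_star_inverse A C V F v"
proof -
  define v where "v = star_right_inverse C F"
  define w where "w = star_right_inverse C v"
  \<comment> \<open>At n = 0 the correction sum consists of the guarded term alone, so v starts with
    the pointwise inverse of the leading matrix of F. Hence v meets the same invertibility condition
    and has a right inverse w.\<close>
  have "(\<chi> i j. 0) = (0 :: complex^'d^'d)"
    by (simp add: vec_eq_iff)
  then have "star_right_inverse_coef C F 0 x = matrix_inv (leading_matrix (F x))" for x
    by (simp add: star_right_inverse_coef.simps[of C F 0])
  then have lead: "leading_matrix (v x) = matrix_inv (leading_matrix (F x))" for x
    by (simp add: v_def star_right_inverse_def leading_matrix_def vec_eq_iff)
  have v: "smooth_matrix_on A V v"
    using smooth_star_right_inverse_coef[OF V inv]
    by (simp add: v_def smooth_matrix_on_def formal_smooth_on_def coef_star_right_inverse)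
  have inv': "invertible (leading_matrix (v x))" if "x \<in> V" for x
    using inv[OF that] matrix_inv_left matrix_inv_right unfolding lead invertible_def by blast
  have w: "smooth_matrix_on A V w"
    using smooth_star_right_inverse_coef[OF V(1) v inv']
    by (simp add: w_def smooth_matrix_on_def formal_smooth_on_def coef_star_right_inverse)
  have Fv: "mat_star C F v x = mat 1" if "x \<in> V" for x
    unfolding v_def using mat_star_right_inverse[OF V that inv] .
  have vw: "mat_star C v w x = mat 1" if "x \<in> V" for x
    unfolding w_def using mat_star_right_inverse[OF V(1) v that inv'] .
  \<comment> \<open>The monoid argument F = F * (v * w) = (F * v) * w = w, valid on V only; locality
    then turns v * w = 1 into v * F = 1.\<close>
  have "F x = w x" if "x \<in> V" for x
  proof -
    have "F x = mat_star C F (mat_star C v w) x"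
      using mat_star_cong[OF V(1,2) smooth_matrix_on_mat_star[OF V(1) v w] refl vw that]
        mat_star_1_right[OF V that] by simp
    also have "\<dots> = mat_star C (mat_star C F v) w x"
      using mat_star_assoc[OF V v w that] by simp
    also have "\<dots> = w x"
      using mat_star_cong[OF V(1) smooth_matrix_on_mat_star[OF V v] w Fv refl that]
        mat_star_1_left[OF V(1) w that] by simp
    finally show ?thesis .
  qed
  then have "mat_star C v F x = mat 1" if "x \<in> V" for x
    using mat_star_cong[OF V(1) v V(2), of v w x] vw that by simp
  with v Fv show ?thesis unfolding is_star_inverse_def smooth_matrix_on_def by blast
qed

end

section \<open>Separation of variables for matrix-valued functions\<close>

lemma (in star_product_sep_vars) mat_star_separation:
  assumes "open V" "\<And>i j. smooth_on A V (\<lambda>x. M x $ i $ j)" "\<And>i j. smooth_on A V (\<lambda>x. N x $ i $ j)"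
    "(\<forall>i j. hol_on A V (\<lambda>x. M x $ i $ j)) \<or> (\<forall>i j. antihol_on A V (\<lambda>x. N x $ i $ j))" "x \<in> V"
  shows "mat_star C (\<lambda>y. const_mat (M y)) (\<lambda>y. const_mat (N y)) x = const_mat (M x ** N x)"
proof -
  have const: "(\<lambda>y. const_mat (P y) $ i $ j) = const_formal (\<lambda>y. P y $ i $ j)" for P :: "'a \<Rightarrow> complex^'d^'d" and i j
    by (simp add: const_mat_def const_formal_def fun_eq_iff)
  \<comment> \<open>Either all entries of M are holomorphic or all entries of N are antiholomorphic,
    so every scalar product occurring in the matrix product separates.\<close>
  have "star C (const_formal (\<lambda>y. M y $ i $ k)) (const_formal (\<lambda>y. N y $ k $ j)) x =
      const_formal (\<lambda>y. M y $ i $ k * N y $ k $ j) x" for i j k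
    using assms by (intro separation[of V]) auto
  then show ?thesis
    by (simp add: mat_star_def const vec_eq_iff)
      (simp add: const_mat_def const_formal_def matrix_matrix_mult_def sum_fps_const)
qed

text \<open>The bundle enters only through its matrices in one frame. The trailing factor
  \<open>u x\<close> is left standing, to be cancelled by the pointwise inverse in the formula for
  the bundle product.\<close>

lemma (in star_product_sep_vars) bundle_star_separation:
  fixes F G u :: "'a \<Rightarrow> complex^'d^'d"
  assumes W: "open W" and x: "x \<in> W"
    and F: "\<And>i j. smooth_on A W (\<lambda>x. F x $ i $ j)"
    and G: "\<And>i j. smooth_on A W (\<lambda>x. G x $ i $ j)"
    and u: "\<And>i j. smooth_on A W (\<lambda>x. u x $ i $ j)"
    and inv: "\<And>x. x \<in> W \<Longrightarrow> invertible (u x)"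
    and v: "is_star_inverse A C W (\<lambda>x. const_mat (u x)) v"
    and sep: "(\<forall>i j. hol_on A W (\<lambda>x. F x $ i $ j)) \<or>
      (\<forall>i j. antihol_on A W (\<lambda>x. (matrix_inv (u x) ** G x ** u x) $ i $ j))"
  shows "mat_star C (mat_star C (\<lambda>y. const_mat (F y ** u y)) v) (\<lambda>y. const_mat (G y ** u y)) x =
    const_mat (F x ** G x ** u x)"
proof -
  have smooth_v: "smooth_matrix_on A W v"
    and uv: "\<And>y. y \<in> W \<Longrightarrow> mat_star C (\<lambda>y. const_mat (u y)) v y = mat 1"
    and vu: "\<And>y. y \<in> W \<Longrightarrow> mat_star C v (\<lambda>y. const_mat (u y)) y = mat 1"
    using v by (simp_all add: is_star_inverse_def smooth_matrix_on_def)
  note Fu = smooth_on_matrix_mult[OF W F u] and Gu = smooth_on_matrix_mult[OF W G u]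
  note mat = smooth_matrix_on_const_mat
  from sep show ?thesis
  proof
    assume hol: "\<forall>i j. hol_on A W (\<lambda>x. F x $ i $ j)"
    have "mat_star C (\<lambda>y. const_mat (F y ** u y)) v y = const_mat (F y)" if y: "y \<in> W" for y
    proof -
      have "mat_star C (\<lambda>y. const_mat (F y ** u y)) v y =
          mat_star C (mat_star C (\<lambda>y. const_mat (F y)) (\<lambda>y. const_mat (u y))) v y"
        using mat_star_separation[OF W F u disjI1[OF hol]]
        by (intro mat_star_cong[OF W mat[OF Fu] smooth_v _ _ y]) simp_all
      also have "\<dots> = mat_star C (\<lambda>y. const_mat (F y)) (mat_star C (\<lambda>y. const_mat (u y)) v) y"
        by (rule mat_star_assoc[OF W mat[OF F] mat[OF u] smooth_v y])
      also have "\<dots> = mat_star C (\<lambda>y. const_mat (F y)) (\<lambda>_. mat 1) y"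
        by (rule mat_star_cong[OF W mat[OF F] smooth_matrix_on_mat_star[OF W mat[OF u] smooth_v] refl uv y])
      also have "\<dots> = const_mat (F y)"
        by (rule mat_star_1_right[OF W mat[OF F] y])
      finally show ?thesis .
    qed
    then have "mat_star C (mat_star C (\<lambda>y. const_mat (F y ** u y)) v) (\<lambda>y. const_mat (G y ** u y)) x =
        mat_star C (\<lambda>y. const_mat (F y)) (\<lambda>y. const_mat (G y ** u y)) x"
      by (rule mat_star_cong[OF W smooth_matrix_on_mat_star[OF W mat[OF Fu] smooth_v] mat[OF Gu] _ refl x])
    also have "\<dots> = const_mat (F x ** (G x ** u x))"
      by (rule mat_star_separation[OF W F Gu disjI1[OF hol] x])
    finally show ?thesis by (simp add: matrix_mul_assoc)
  next
    \<comment> \<open>This is the matrix whose entries antiholomorphy of g speaks about. As the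
      right-hand factor of u * N it separates although u is neither holomorphic nor antiholomorphic
      in general.\<close>
    define N where "N y = matrix_inv (u y) ** G y ** u y" for y
    assume "\<forall>i j. antihol_on A W (\<lambda>x. (matrix_inv (u x) ** G x ** u x) $ i $ j)"
    then have antihol: "\<forall>i j. antihol_on A W (\<lambda>x. N x $ i $ j)"
      by (simp add: N_def)
    have N: "smooth_on A W (\<lambda>x. N x $ i $ j)" for i j
      unfolding N_def by (intro smooth_on_matrix_mult smooth_on_matrix_inv W G u inv)
    have uN: "u y ** N y = G y ** u y" if "y \<in> W" for y
      using inv[OF that] by (simp add: N_def matrix_mul_assoc matrix_inv_right)
    have vN: "mat_star C v (\<lambda>y. const_mat (G y ** u y)) y = const_mat (N y)" if y: "y \<in> W" for y
    proof -
      have "mat_star C v (\<lambda>y. const_mat (G y ** u y)) y =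
          mat_star C v (mat_star C (\<lambda>y. const_mat (u y)) (\<lambda>y. const_mat (N y))) y"
        using mat_star_separation[OF W u N disjI2[OF antihol]]
        by (intro mat_star_cong[OF W smooth_v mat[OF Gu] _ _ y]) (simp_all add: uN)
      also have "\<dots> = mat_star C (mat_star C v (\<lambda>y. const_mat (u y))) (\<lambda>y. const_mat (N y)) y"
        by (rule mat_star_assoc[OF W smooth_v mat[OF u] mat[OF N] y, symmetric])
      also have "\<dots> = mat_star C (\<lambda>_. mat 1) (\<lambda>y. const_mat (N y)) y"
        by (rule mat_star_cong[OF W smooth_matrix_on_mat_star[OF W smooth_v mat[OF u]] mat[OF N] vu refl y])
      also have "\<dots> = const_mat (N y)"
        by (rule mat_star_1_left[OF W mat[OF N] y])
      finally show ?thesis .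
    qed
    have "mat_star C (mat_star C (\<lambda>y. const_mat (F y ** u y)) v) (\<lambda>y. const_mat (G y ** u y)) x =
        mat_star C (\<lambda>y. const_mat (F y ** u y)) (mat_star C v (\<lambda>y. const_mat (G y ** u y))) x"
      by (rule mat_star_assoc[OF W mat[OF Fu] smooth_v mat[OF Gu] x])
    also have "\<dots> = mat_star C (\<lambda>y. const_mat (F y ** u y)) (\<lambda>y. const_mat (N y)) x"
      by (rule mat_star_cong[OF W mat[OF Fu] smooth_matrix_on_mat_star[OF W smooth_v mat[OF Gu]] refl vN x])
    also have "\<dots> = const_mat (F x ** u x ** N x)"
      by (rule mat_star_separation[OF W Fu N disjI2[OF antihol] x])
    also have "F x ** u x ** N x = F x ** (u x ** N x)"
      by (simp add: matrix_mul_assoc)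
    finally show ?thesis by (simp add: uN[OF x] matrix_mul_assoc)
  qed
qed


subsection \<open>Endomorphisms of the dual bundle in a frame\<close>

lemma dual_fibreD:
  assumes "s \<in> dual_fibre E x"
  shows dual_fibre_add: "v \<in> fibre E x \<Longrightarrow> w \<in> fibre E x \<Longrightarrow> s (v + w) = s v + s w"
    and dual_fibre_scale: "v \<in> fibre E x \<Longrightarrow> s (scaleE E c v) = c * s v"
    and dual_fibre_outside: "v \<notin> fibre E x \<Longrightarrow> s v = 0"
  using assms by (auto simp: dual_fibre_def)

lemma dual_fibre_sum:
  "(\<And>i. i \<in> I \<Longrightarrow> s i \<in> dual_fibre E x) \<Longrightarrow> (\<lambda>v. \<Sum>i\<in>I. c i * s i v) \<in> dual_fibre E x"
  by (auto simp: dual_fibre_def sum.distrib sum_distrib_left algebra_simps)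

lemma dual_endosD:
  assumes "T \<in> dual_endos E x" "s \<in> dual_fibre E x"
  shows dual_endos_maps: "T s \<in> dual_fibre E x"
    and dual_endos_add: "t \<in> dual_fibre E x \<Longrightarrow> T (\<lambda>v. s v + t v) = (\<lambda>v. T s v + T t v)"
    and dual_endos_scale: "T (\<lambda>v. c * s v) = (\<lambda>v. c * T s v)"
  using assms by (auto simp: dual_endos_def)

lemma dual_endos_sum:
  assumes T: "T \<in> dual_endos E x" and "finite I" and s: "\<And>i. i \<in> I \<Longrightarrow> s i \<in> dual_fibre E x"
  shows "T (\<lambda>v. \<Sum>i\<in>I. c i * s i v) = (\<lambda>v. \<Sum>i\<in>I. c i * T (s i) v)"
  using assms(2) s
proof (induction I)
  case empty
  have "(\<lambda>_. 0) \<in> dual_fibre E x" by (simp add: dual_fibre_def)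
  then show ?case using dual_endos_scale[OF T, of "\<lambda>_. 0" 0] by simp
next
  case (insert i I)
  have "(\<lambda>v. c i * s i v) \<in> dual_fibre E x" "(\<lambda>v. \<Sum>i\<in>I. c i * s i v) \<in> dual_fibre E x"
    using dual_fibre_sum[of "{i}" s E x c] dual_fibre_sum[of I s E x c] insert.prems by simp_all
  then show ?case
    using insert dual_endos_add[OF T] dual_endos_scale[OF T, of "s i" "c i"] by simp
qed

lemma compose_section_dual_endos:
  "f x \<in> dual_endos E x \<Longrightarrow> g x \<in> dual_endos E x \<Longrightarrow> compose_section f g x \<in> dual_endos E x"
  by (simp add: dual_endos_def compose_section_def)

lemma zero_dual_endos: "(\<lambda>s v. 0) \<in> dual_endos E x"
  by (simp add: dual_endos_def dual_fibre_def)

context holomorphic_vector_bundle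
begin

interpretation ambient: vector_space "scaleE E"
  by (rule ambient_vector_space)

text \<open>The functionals are the coordinates with respect to the frame, set to 0 off the fibre as
  \<open>dual_fibre\<close> demands. Their columns are the unit vectors, so they detect single
  matrix entries.\<close>

lemma dual_basis_exists:
  assumes "frame_on E W e" "x \<in> W"
  obtains \<epsilon> where "\<And>j. \<epsilon> j \<in> dual_fibre E x" "\<And>i j. \<epsilon> j (e i x) = (if i = j then 1 else 0)"
proof
  let ?B = "range (\<lambda>i. e i x)"
  let ?\<epsilon> = "\<lambda>j v. if v \<in> fibre E x then ambient.representation ?B v (e j x) else 0"
  have inj: "inj (\<lambda>i. e i x)" and indep: "ambient.independent ?B" and span: "ambient.span ?B = fibre E x"
    using assms unfolding frame_on_def by auto
  show "?\<epsilon> j \<in> dual_fibre E x" for j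
    unfolding dual_fibre_def span[symmetric]
    by (simp add: ambient.representation_add ambient.representation_scale indep
        ambient.span_add ambient.span_scale)
  show "?\<epsilon> j (e i x) = (if i = j then 1 else 0)" for i j
    unfolding span[symmetric]
    by (auto simp: ambient.representation_basis[OF indep] ambient.span_base dest: injD[OF inj])
qed

lemma dual_fibre_eqI:
  assumes e: "frame_on E W e" "x \<in> W" and s: "s \<in> dual_fibre E x" and t: "t \<in> dual_fibre E x"
    and eq: "column e x s = column e x t"
  shows "s = t"
proof
  fix v
  let ?B = "range (\<lambda>i. e i x)"
  have span: "ambient.span ?B = fibre E x"
    using e unfolding frame_on_def by auto
  have on_B: "s (e i x) = t (e i x)" for i
    using eq by (simp add: column_def vec_eq_iff)
  show "s v = t v"
  proof (cases "v \<in> fibre E x")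
    case True
    then have "v \<in> ambient.span ?B" using span by simp
    \<comment> \<open>Membership in the fibre is carried along because s and t are additive only
      there.\<close>
    then have "v \<in> fibre E x \<and> s v = t v"
    proof (induction rule: ambient.span_induct_alt)
      case base
      have "0 \<in> fibre E x" using span ambient.span_zero by blast
      then show ?case
        using dual_fibre_scale[OF s, of 0 0] dual_fibre_scale[OF t, of 0 0] by simp
    next
      case (step c b w)
      then obtain i where b: "b = e i x" by blast
      have "b \<in> fibre E x" "scaleE E c b \<in> fibre E x"
        using step(1) span ambient.span_base ambient.span_scale by blast+
      moreover have "scaleE E c b + w \<in> fibre E x"
        using calculation step span ambient.span_add by blast
      ultimately show ?case
        using step by (simp add: dual_fibre_add[OF s] dual_fibre_add[OF t]
            dual_fibre_scale[OF s] dual_fibre_scale[OF t] b on_B)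
    qed
    then show ?thesis by simp
  qed (simp add: dual_fibre_outside[OF s] dual_fibre_outside[OF t])
qed

text \<open>Discharges the uniqueness hidden in the \<open>THE\<close> of \<open>matrix_in\<close>:
  two representing matrices agree on the columns of the dual basis, hence entrywise.\<close>

lemma matrix_in_eqI:
  assumes e: "frame_on E W e" "x \<in> W"
    and F: "\<And>s. s \<in> dual_fibre E x \<Longrightarrow> column e x (f x s) = F *v column e x s"
  shows "matrix_in E e f x = F"
  unfolding matrix_in_def
proof (rule the_equality)
  show "\<forall>s\<in>dual_fibre E x. column e x (f x s) = F *v column e x s" using F by blast
next
  fix F' assume F': "\<forall>s\<in>dual_fibre E x. column e x (f x s) = F' *v column e x s"
  obtain \<epsilon> where \<epsilon>: "\<And>j. \<epsilon> j \<in> dual_fibre E x" "\<And>i j. \<epsilon> j (e i x) = (if i = j then 1 else 0)"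
    using dual_basis_exists[OF e] by blast
  have entry: "(M *v column e x (\<epsilon> j)) $ i = M $ i $ j" for M :: "complex^'d^'d" and i j
    by (simp add: matrix_vector_mult_def column_def \<epsilon>(2) if_distrib[of "\<lambda>z. _ * z"] cong: if_cong)
  have "F' *v column e x (\<epsilon> j) = F *v column e x (\<epsilon> j)" for j
    using F F' \<epsilon>(1) by metis
  then have "F' $ i $ j = F $ i $ j" for i j
    by (metis entry)
  then show "F' = F" by (simp add: vec_eq_iff)
qed

lemma column_matrix_in:
  assumes e: "frame_on E W e" "x \<in> W" and f: "f x \<in> dual_endos E x" and s: "s \<in> dual_fibre E x"
  shows "column e x (f x s) = matrix_in E e f x *v column e x s"
proof -
  obtain \<epsilon> where \<epsilon>: "\<And>j. \<epsilon> j \<in> dual_fibre E x" "\<And>i j. \<epsilon> j (e i x) = (if i = j then 1 else 0)"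
    using dual_basis_exists[OF e] by blast
  \<comment> \<open>Column j is the image of the j-th dual basis element in the frame; expanding s
    in the dual basis shows that this matrix represents f.\<close>
  define F where "F = (\<chi> i j. f x (\<epsilon> j) (e i x))"
  have F: "column e x (f x s) = F *v column e x s" if s: "s \<in> dual_fibre E x" for s
  proof -
    have "s = (\<lambda>v. \<Sum>j\<in>UNIV. s (e j x) * \<epsilon> j v)"
      by (rule dual_fibre_eqI[OF e s dual_fibre_sum[OF \<epsilon>(1)]])
        (simp add: column_def \<epsilon>(2) if_distrib[of "\<lambda>z. _ * z"] cong: if_cong)
    then have "f x s = f x (\<lambda>v. \<Sum>j\<in>UNIV. s (e j x) * \<epsilon> j v)"
      by (rule arg_cong)
    also have "\<dots> = (\<lambda>v. \<Sum>j\<in>UNIV. s (e j x) * f x (\<epsilon> j) v)"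
      by (intro dual_endos_sum[OF f finite] \<epsilon>(1))
    finally show ?thesis
      by (simp add: F_def column_def matrix_vector_mult_def vec_eq_iff mult.commute)
  qed
  then show ?thesis using matrix_in_eqI[of W e x f, OF e F] s by simp
qed

lemma matrix_in_compose_section:
  assumes e: "frame_on E W e" "x \<in> W" and f: "f x \<in> dual_endos E x" and g: "g x \<in> dual_endos E x"
  shows "matrix_in E e (compose_section f g) x = matrix_in E e f x ** matrix_in E e g x"
proof (rule matrix_in_eqI[OF e])
  fix s assume s: "s \<in> dual_fibre E x"
  then have "g x s \<in> dual_fibre E x" by (rule dual_endos_maps[OF g])
  then show "column e x (compose_section f g x s) =
      (matrix_in E e f x ** matrix_in E e g x) *v column e x s"
    using column_matrix_in[of W e x f, OF e f] column_matrix_in[of W e x g, OF e g s]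
    by (simp add: compose_section_def matrix_vector_mul_assoc)
qed

lemma matrix_in_zero:
  assumes "frame_on E W e" "x \<in> W"
  shows "matrix_in E e (\<lambda>x s v. 0) x = 0"
  by (rule matrix_in_eqI[OF assms]) (simp add: column_def vec_eq_iff)

lemma formal_matrix_in_const_section:
  assumes "frame_on E W e" "x \<in> W"
  shows "formal_matrix_in E e (const_section f) x = const_mat (matrix_in E e f x)"
  using matrix_in_zero[OF assms]
  by (simp add: formal_matrix_in_def const_mat_def const_section_def vec_eq_iff fps_eq_iff)

lemma formal_smooth_section_const_section:
  assumes "smooth_section A E U f"
  shows "formal_smooth_section A E U (const_section f)"
proof -
  have "smooth_on A W (\<lambda>x. matrix_in E e (\<lambda>x s v. 0) x $ i $ j)"
    if "holomorphic_frame A E W e" for W e i j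
    using that matrix_in_zero[of W e] smooth_on_const[of A W 0]
      smooth_on_cong[of W "\<lambda>x. matrix_in E e (\<lambda>x s v. 0) x $ i $ j" "\<lambda>_. 0"]
    by (simp add: holomorphic_frame_def)
  then have "smooth_section A E U (\<lambda>x s v. 0)"
    by (simp add: smooth_section_def zero_dual_endos)
  then show ?thesis using assms by (simp add: formal_smooth_section_def const_section_def)
qed

end

text \<open>Positivity makes the kernel of the transposed Gram matrix trivial: a kernel vector gives
  the coordinates of a w orthogonal to the whole frame, so w has norm 0 and vanishes. The transpose
  appears because the metric is linear in its first argument.\<close>

lemma (in holomorphic_hermitian_bundle) metric_matrix_invertible:
  assumes e: "frame_on E W e" "x \<in> W"
  shows "invertible (metric_matrix E e x)"
proof -
  interpret ambient: vector_space "scaleE E" by (rule ambient_vector_space)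
  let ?B = "range (\<lambda>i. e i x)"
  have inj: "inj (\<lambda>i. e i x)" and indep: "ambient.independent ?B" and span: "ambient.span ?B = fibre E x"
    using e unfolding frame_on_def by auto
  have e_fibre: "e i x \<in> fibre E x" for i
    unfolding span[symmetric] by (intro ambient.span_base rangeI)
  have sum_fibre: "(\<Sum>i\<in>I. scaleE E (c i) (e i x)) \<in> fibre E x" for c I
    unfolding span[symmetric] by (intro ambient.span_sum ambient.span_scale ambient.span_base rangeI)
  have metric_sum: "metric E x (\<Sum>i\<in>I. scaleE E (c i) (e i x)) w = (\<Sum>i\<in>I. c i * metric E x (e i x) w)"
    if w: "w \<in> fibre E x" and "finite I" for c I w
    using that(2)
  proof (induction I)
    case empty
    show ?case using metric_linear[OF w w w, of 0 0] by simp
  next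
    case (insert i I)
    then show ?case
      using metric_linear[OF e_fibre sum_fibre w, of "c i" i 1 c I] by simp
  qed
  have "c = 0" if "transpose (metric_matrix E e x) *v c = 0" for c
  proof -
    define w where "w = (\<Sum>i\<in>UNIV. scaleE E (c $ i) (e i x))"
    have w: "w \<in> fibre E x" unfolding w_def by (rule sum_fibre)
    have "metric E x w (e j x) = 0" for j
      using arg_cong[OF that, of "\<lambda>v. v $ j"]
      unfolding w_def metric_sum[OF e_fibre finite]
      by (simp add: matrix_vector_mult_def transpose_def metric_matrix_def mult.commute)
    \<comment> \<open>Sums can be expanded only in the first argument, so Hermitian symmetry moves w
      to the second before w is expanded again.\<close>
    then have "metric E x (e j x) w = 0" for j
      using metric_hermitian[OF w e_fibre, of j] by simp
    then have "metric E x w w = 0"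
      by (subst (1) w_def) (simp add: metric_sum[OF w])
    then have "w = 0"
      using metric_positive[OF w] by force
    \<comment> \<open>Independence is stated for the set of frame vectors, so the sum over indices
      is transported along the injective frame.\<close>
    then have "(\<Sum>b\<in>?B. scaleE E (c $ inv (\<lambda>i. e i x) b) b) = 0"
      by (simp add: sum.reindex[OF inj] w_def inv_f_f[OF inj])
    then have "c $ inv (\<lambda>i. e i x) (e j x) = 0" for j
      by (intro ambient.independentD[OF indep]) auto
    then show ?thesis by (simp add: vec_eq_iff inv_f_f[OF inj])
  qed
  then have "\<exists>B. metric_matrix E e x ** B = mat 1"
    using matrix_left_invertible_ker left_invertible_transpose by blast
  then show ?thesis by (simp add: invertible_right_inverse)
qed

theorem lemma4:
  fixes A :: "('a::{t2_space,second_countable_topology}, 'n::finite) chart set"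
    and br :: "'a biop"
    and C :: "nat \<Rightarrow> 'a biop"
    and E :: "('a, 'v::ab_group_add, 'd::finite) hermitian_bundle"
    and star_u :: "('a, 'v) formal_section \<Rightarrow> ('a, 'v) formal_section \<Rightarrow> ('a, 'v) formal_section"
    and U :: "'a set"
    and f g :: "'a \<Rightarrow> 'v dual_endo"
  assumes "kaehler_poisson_manifold A br"
    and "star_product_sep_vars A br C"
    and "holomorphic_hermitian_bundle A E"
    and "is_bundle_star A C E star_u"
    and "open U"
    and "smooth_section A E U f"
    and "smooth_section A E U g"
    and "holomorphic_section A E U f \<or> antiholomorphic_section A E U g"
  shows "formal_section_eq_on E U
           (star_u (const_section f) (const_section g))
           (const_section (compose_section f g))"
  unfolding formal_section_eq_on_def
proof (intro allI ballI)
  interpret star_product_sep_vars A br C by fact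
  interpret holomorphic_hermitian_bundle A E by fact
  fix n x s assume x: "x \<in> U" and s: "s \<in> dual_fibre E x"
  let ?h = "star_u (const_section f) (const_section g)"
  obtain W e where W: "x \<in> W" "W \<subseteq> U" "holomorphic_frame A E W e"
    and sep: "(\<forall>i j. hol_on A W (\<lambda>x. matrix_in E e f x $ i $ j)) \<or>
      (\<forall>i j. antihol_on A W (\<lambda>x.
        (matrix_inv (metric_matrix E e x) ** matrix_in E e g x ** metric_matrix E e x) $ i $ j))"
    using assms(8) x unfolding holomorphic_section_def antiholomorphic_section_def by blast
  let ?u = "metric_matrix E e" and ?F = "matrix_in E e f" and ?G = "matrix_in E e g"
  have "open W" and frame: "frame_on E W e"
    using W(3) by (simp_all add: holomorphic_frame_def)
  have f: "y \<in> U \<Longrightarrow> f y \<in> dual_endos E y" and g: "y \<in> U \<Longrightarrow> g y \<in> dual_endos E y" for y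
    using assms(6,7) by (simp_all add: smooth_section_def)
  have F: "smooth_on A W (\<lambda>x. ?F x $ i $ j)" and G: "smooth_on A W (\<lambda>x. ?G x $ i $ j)" for i j
    using assms(6,7) W(2,3) by (simp_all add: smooth_section_def)
  note u = metric_smooth[OF W(3)] and u_inv = metric_matrix_invertible[OF frame]
  \<comment> \<open>The formula in \<open>is_bundle_star\<close> is conditional on such a v and says
    nothing about \<open>star_u\<close> until one exists.\<close>
  obtain v where v: "is_star_inverse A C W (\<lambda>x. const_mat (?u x)) v"
    using star_inverse_exists[OF \<open>open W\<close> smooth_matrix_on_const_mat[OF u]] u_inv
    by (auto simp: leading_matrix_const_mat)
  then have smooth_v: "smooth_matrix_on A W v"
    by (simp add: is_star_inverse_def smooth_matrix_on_def)
  note smooth_Fu = smooth_matrix_on_const_mat[OF smooth_on_matrix_mult[OF \<open>open W\<close> F u]]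
    and smooth_Gu = smooth_matrix_on_const_mat[OF smooth_on_matrix_mult[OF \<open>open W\<close> G u]]
  have const: "formal_matrix_in E e (const_section k) y ** const_mat (?u y) =
      const_mat (matrix_in E e k y ** ?u y)" if "y \<in> W" for k y
    by (simp add: formal_matrix_in_const_section[OF frame that] const_mat_mult)
  have star_formula: "formal_smooth_section A E U ?h"
    "formal_matrix_in E e ?h x =
      mat_star C
        (mat_star C (\<lambda>y. formal_matrix_in E e (const_section f) y ** const_mat (?u y)) v)
        (\<lambda>y. formal_matrix_in E e (const_section g) y ** const_mat (?u y)) x
      ** const_mat (matrix_inv (?u x))"
    using assms(4,5) formal_smooth_section_const_section[OF assms(6)]
      formal_smooth_section_const_section[OF assms(7)] W v
    unfolding is_bundle_star_def by blast+
  \<comment> \<open>The matrix of a constant formal section is the constant matrix only at points of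
    W, so the replacement under the star product goes through locality, here for the inner and then
    for the outer product.\<close>
  have "mat_star C (\<lambda>y. const_mat (?F y ** ?u y)) v y =
      mat_star C (\<lambda>y. formal_matrix_in E e (const_section f) y ** const_mat (?u y)) v y"
    if "y \<in> W" for y
    by (rule mat_star_cong[OF \<open>open W\<close> smooth_Fu smooth_v const[symmetric] refl that])
  then have "mat_star C (mat_star C (\<lambda>y. const_mat (?F y ** ?u y)) v) (\<lambda>y. const_mat (?G y ** ?u y)) x =
      mat_star C
        (mat_star C (\<lambda>y. formal_matrix_in E e (const_section f) y ** const_mat (?u y)) v)
        (\<lambda>y. formal_matrix_in E e (const_section g) y ** const_mat (?u y)) x"
    by (rule mat_star_cong[OF \<open>open W\<close> smooth_matrix_on_mat_star[OF \<open>open W\<close> smooth_Fu smooth_v]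
          smooth_Gu _ const[symmetric] W(1)])
  then have "formal_matrix_in E e ?h x = const_mat (?F x ** ?G x ** ?u x) ** const_mat (matrix_inv (?u x))"
    using star_formula(2) bundle_star_separation[OF \<open>open W\<close> W(1) F G u u_inv v sep] by simp
  also have "\<dots> = const_mat (?F x ** ?G x ** (?u x ** matrix_inv (?u x)))"
    by (simp add: const_mat_mult matrix_mul_assoc)
  also have "\<dots> = const_mat (matrix_in E e (compose_section f g) x)"
    using matrix_in_compose_section[of W e x f g, OF frame W(1) f[OF x] g[OF x]] u_inv[OF W(1)]
    by (simp add: matrix_inv_right)
  also have "\<dots> = formal_matrix_in E e (const_section (compose_section f g)) x"
    by (rule formal_matrix_in_const_section[OF frame W(1), symmetric])
  finally have eq: "matrix_in E e (?h n) x = matrix_in E e (const_section (compose_section f g) n) x"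
    by (simp add: formal_matrix_in_def vec_eq_iff fps_eq_iff)
  \<comment> \<open>Equal matrices give equal values only for genuine endomorphisms of the dual
    fibre; for \<open>star_u\<close> this is part of the smoothness of its result.\<close>
  have h: "?h n x \<in> dual_endos E x"
    using star_formula(1) x by (simp add: formal_smooth_section_def smooth_section_def)
  have fg: "const_section (compose_section f g) n x \<in> dual_endos E x"
    using compose_section_dual_endos[of f x E g, OF f[OF x] g[OF x]]
    by (simp add: const_section_def zero_dual_endos)
  show "?h n x s = const_section (compose_section f g) n x s"
  proof (rule dual_fibre_eqI[OF frame W(1)])
    show "?h n x s \<in> dual_fibre E x" "const_section (compose_section f g) n x s \<in> dual_fibre E x"
      using h fg s by (blast intro: dual_endos_maps)+
    show "column e x (?h n x s) = column e x (const_section (compose_section f g) n x s)"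
      using column_matrix_in[OF frame W(1), of "?h n", OF h s]
        column_matrix_in[OF frame W(1), of "const_section (compose_section f g) n", OF fg s] eq by simp
  qed
qed

end
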